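(* Let $P\in\mathcal S$, $P\stackrel{\Lambda}{\sim}Q\in\mathcal N$, be the transition kernel of an ergodic Markov chain with invariant distribution $\pi$, that is, $\pi P=\pi$, and assume that $P$ is compact. (1) For any $n\in\mathbb N_0$, $$\lambda_*^n\le\|P^n-\pi\|_{\ell^2(\pi)\to\ell^2(\pi)}\le\min\big(\sigma_*^n(P),\kappa(\Lambda)\lambda_*^n\big)=\sigma_*^n(P)\mathbf 1_{\{n<n^*\}}+\kappa(\Lambda)\lambda_*^n\mathbf 1_{\{n\ge n^*\}},$$ where $$n^*=\Big\lceil\frac{\ln\kappa(\Lambda)}{\ln\sigma_*(P)-\ln\lambda_*}\Big\rceil$$ and $\kappa(\Lambda)=\|\Lambda\|_{\ell^2(\pi_Q)\to\ell^2(\pi)}\,\|\Lambda^{-1}\|_{\ell^2(\pi)\to\ell^2(\pi_Q)}\ge1$ is the condition number of $\Lambda$. When $\mathcal X$ is a finite state space, a sufficient condition for $\lambda_*<\sigma_*(P)$ is $\max_{i\in\mathcal X}P(i,i)>\lambda_*$. In such case, for $n$ large enough, the convergence rate $\lambda_*$ given by the upper bound above is strictly better than the reversibilization rate $\sigma_*(P)$. (2) Suppose that $\mathcal X$ is a finite state space. For any $n\in\mathbb N_0$, $$d(n)\le\frac{\min\big(\sigma_*^n(P),\kappa(\Lambda)\lambda_*^n\big)}{2}\sqrt{\frac{1-\pi_{min}}{\pi_{min}}},$$ where $\lambda_*\le\sigma_*(P)$.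
   Context: $\mathcal X$ is a countable state space, $\mathcal M$ the set of Markov transition kernels on $\mathcal X$. Each kernel comes with a strictly positive reference measure (here $\pi$ for $P$ and $\pi_Q$ for $Q$). $\ell^2(\pi)$ is the Hilbert space of complex functions on $\mathcal X$ with $\sum_x|f(x)|^2\pi(x)<\infty$ and $\langle f,g\rangle_\pi=\sum_xf(x)\overline{g(x)}\pi(x)$. $\widehat P$ is the time-reversal, $\pi(x)\widehat P(x,y)=\pi(y)P(y,x)$, i.e. the adjoint of $P$ in $\ell^2(\pi)$. $P\stackrel{\Lambda}{\sim}Q$ means that $\Lambda:\ell^2(\pi_Q)\to\ell^2(\pi)$ is bounded with bounded inverse and $P\Lambda=\Lambda Q$. $\mathcal N$ is the set of normal transition kernels ($Q\widehat Q=\widehat QQ$ in $\ell^2(\pi_Q)$), and $\mathcal S$ is the set of $P\in\mathcal M$ similar in this sense to some $Q\in\mathcal N$. In $P^n-\pi$, $\pi$ denotes the operator $f\mapsto\big(\sum_xf(x)\pi(x)\big)\mathbf 1$. The second largest eigenvalue in modulus of $P$, i.e. the spectral radius of $P$ on $\ell^2_0(\pi)=\{f\in\ell^2(\pi):\langle f,\mathbf 1\rangle_\pi=0\}$, is denoted $\lambda_*=\lambda_*(P)=\sup\{|\lambda_i|;\ \lambda_i\in\sigma(P),\ \lambda_i\ne1\}$, with $\sigma(P)$ the spectrum of $P$. $\sigma_*(P)=\sqrt{\lambda_*(P\widehat P)}$ is the second largest singular value of $P$; it is the rate obtained by reversibilization. For finite $\mathcal X$, $\pi_{min}=\min_{x}\pi(x)$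 and $d(n)=\max_{x\in\mathcal X}\|\delta_xP^n-\pi\|_{TV}$ with $\|\mu-\nu\|_{TV}=\frac12\sum_x|\mu(x)-\nu(x)|$.
   Formalization: The sufficient condition max P(i,i) > λ_* is false as printed (two states, all entries 1/2: λ_* = σ_* = 0) and is replaced by max (P(i,i) − π(i)) > λ_*; the state space is assumed to have at least two points. *)

theory Defs
  imports "HOL-Analysis.Analysis" "HOL-Library.Extended_Nat"
begin

section \<open>Weighted square-summable functions and their bounded operators\<close>

text \<open>
  The countable state space is a type of class \<open>countable\<close>, finite or infinite.
  The weight \<open>p\<close> is always strictly positive where these notions are used, so
  elements of the Hilbert space are honest functions and no quotient is needed.
\<close>

definition l2 :: "('a \<Rightarrow> real) \<Rightarrow> ('a \<Rightarrow> complex) set" where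
  "l2 p = {f. (\<lambda>x. (cmod (f x))\<^sup>2 * p x) summable_on UNIV}"

definition l2_norm :: "('a \<Rightarrow> real) \<Rightarrow> ('a \<Rightarrow> complex) \<Rightarrow> real" where
  "l2_norm p f = sqrt (\<Sum>\<^sub>\<infinity>x. (cmod (f x))\<^sup>2 * p x)"

definition l2_inner :: "('a \<Rightarrow> real) \<Rightarrow> ('a \<Rightarrow> complex) \<Rightarrow> ('a \<Rightarrow> complex) \<Rightarrow> complex" where
  "l2_inner p f g = (\<Sum>\<^sub>\<infinity>x. f x * cnj (g x) * of_real (p x))"

definition l2_0 :: "('a \<Rightarrow> real) \<Rightarrow> ('a \<Rightarrow> complex) set" where
  "l2_0 p = {f \<in> l2 p. l2_inner p f (\<lambda>_. 1) = 0}"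

definition bounded_op ::
  "('a \<Rightarrow> real) \<Rightarrow> ('b \<Rightarrow> real) \<Rightarrow> (('a \<Rightarrow> complex) \<Rightarrow> ('b \<Rightarrow> complex)) \<Rightarrow> bool" where
  "bounded_op p q T \<longleftrightarrow>
     (\<forall>f\<in>l2 p. T f \<in> l2 q) \<and>
     (\<forall>f\<in>l2 p. \<forall>g\<in>l2 p. \<forall>a b. T (\<lambda>x. a * f x + b * g x) = (\<lambda>x. a * T f x + b * T g x)) \<and>
     (\<exists>C. \<forall>f\<in>l2 p. l2_norm q (T f) \<le> C * l2_norm p f)"

definition op_norm ::
  "('a \<Rightarrow> real) \<Rightarrow> ('b \<Rightarrow> real) \<Rightarrow> (('a \<Rightarrow> complex) \<Rightarrow> ('b \<Rightarrow> complex)) \<Rightarrow> real" where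
  "op_norm p q T = (SUP f\<in>{f \<in> l2 p. l2_norm p f \<le> 1}. l2_norm q (T f))"

definition compact_op ::
  "('a \<Rightarrow> real) \<Rightarrow> ('b \<Rightarrow> real) \<Rightarrow> (('a \<Rightarrow> complex) \<Rightarrow> ('b \<Rightarrow> complex)) \<Rightarrow> bool" where
  "compact_op p q T \<longleftrightarrow> bounded_op p q T \<and>
     (\<forall>f :: nat \<Rightarrow> 'a \<Rightarrow> complex. (\<forall>n. f n \<in> l2 p \<and> l2_norm p (f n) \<le> 1) \<longrightarrow>
        (\<exists>g\<in>l2 q. \<exists>r. strict_mono r \<and>
           (\<lambda>n. l2_norm q (\<lambda>x. T (f (r n)) x - g x)) \<longlonglongrightarrow> 0))"

text \<open>
  Spectrum of the restriction of \<open>T\<close> to a closed invariant subspace \<open>V\<close> of \<open>l2 p\<close>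
  (\<open>V = l2 p\<close> gives the spectrum of \<open>T\<close> itself).
\<close>

definition spectrum_on ::
  "('a \<Rightarrow> real) \<Rightarrow> ('a \<Rightarrow> complex) set \<Rightarrow> (('a \<Rightarrow> complex) \<Rightarrow> ('a \<Rightarrow> complex)) \<Rightarrow> complex set" where
  "spectrum_on p V T = {z.
     \<not> (bij_betw (\<lambda>f x. z * f x - T f x) V V \<and>
        (\<exists>C. \<forall>g\<in>V. l2_norm p (inv_into V (\<lambda>f x. z * f x - T f x) g) \<le> C * l2_norm p g))}"

definition spectral_radius_on ::
  "('a \<Rightarrow> real) \<Rightarrow> ('a \<Rightarrow> complex) set \<Rightarrow> (('a \<Rightarrow> complex) \<Rightarrow> ('a \<Rightarrow> complex)) \<Rightarrow> real" where
  "spectral_radius_on p V T = (SUP z\<in>spectrum_on p V T. cmod z)"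

section \<open>Markov kernels\<close>

definition markov_kernel :: "('a \<Rightarrow> 'a \<Rightarrow> real) \<Rightarrow> bool" where
  "markov_kernel P \<longleftrightarrow> (\<forall>x y. P x y \<ge> 0) \<and> (\<forall>x. (P x has_sum 1) UNIV)"

definition kernel_op :: "('a \<Rightarrow> 'a \<Rightarrow> real) \<Rightarrow> ('a \<Rightarrow> complex) \<Rightarrow> ('a \<Rightarrow> complex)" where
  "kernel_op P f = (\<lambda>x. \<Sum>\<^sub>\<infinity>y. of_real (P x y) * f y)"

fun kernel_pow :: "('a \<Rightarrow> 'a \<Rightarrow> real) \<Rightarrow> nat \<Rightarrow> 'a \<Rightarrow> 'a \<Rightarrow> real" where
  "kernel_pow P 0 x y = (if x = y then 1 else 0)"
| "kernel_pow P (Suc n) x y = (\<Sum>\<^sub>\<infinity>z. P x z * kernel_pow P n z y)"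

definition time_reversal :: "('a \<Rightarrow> real) \<Rightarrow> ('a \<Rightarrow> 'a \<Rightarrow> real) \<Rightarrow> 'a \<Rightarrow> 'a \<Rightarrow> real" where
  "time_reversal p P x y = p y * P y x / p x"

definition invariant_distribution :: "('a \<Rightarrow> 'a \<Rightarrow> real) \<Rightarrow> ('a \<Rightarrow> real) \<Rightarrow> bool" where
  "invariant_distribution P \<pi> \<longleftrightarrow> (\<forall>x. \<pi> x \<ge> 0) \<and> (\<pi> has_sum 1) UNIV \<and>
     (\<forall>y. ((\<lambda>x. \<pi> x * P x y) has_sum \<pi> y) UNIV)"

definition irreducible_kernel :: "('a \<Rightarrow> 'a \<Rightarrow> real) \<Rightarrow> bool" where
  "irreducible_kernel P \<longleftrightarrow> (\<forall>x y. \<exists>n. kernel_pow P n x y > 0)"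

definition aperiodic_kernel :: "('a \<Rightarrow> 'a \<Rightarrow> real) \<Rightarrow> bool" where
  "aperiodic_kernel P \<longleftrightarrow> (\<forall>x. Gcd {n. n > 0 \<and> kernel_pow P n x x > 0} = 1)"

text \<open>
  Ergodic means irreducible, aperiodic and positive recurrent; positive recurrence is
  not listed because it is automatic once an invariant probability exists.
\<close>

definition ergodic_kernel :: "('a \<Rightarrow> 'a \<Rightarrow> real) \<Rightarrow> ('a \<Rightarrow> real) \<Rightarrow> bool" where
  "ergodic_kernel P \<pi> \<longleftrightarrow>
     irreducible_kernel P \<and> aperiodic_kernel P \<and> invariant_distribution P \<pi>"

text \<open>
  The reference measure of a normal kernel is only required to be strictly positive; it
  need be neither finite nor invariant. Linearity of \<open>kernel_op Q\<close> on all of \<open>l2 q\<close> forces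
  the sums defining it to converge (the default value of a divergent \<open>infsum\<close> would
  break additivity), and boundedness makes \<open>kernel_op (time_reversal q Q)\<close> its adjoint.
\<close>

definition normal_kernel :: "('a \<Rightarrow> real) \<Rightarrow> ('a \<Rightarrow> 'a \<Rightarrow> real) \<Rightarrow> bool" where
  "normal_kernel q Q \<longleftrightarrow> markov_kernel Q \<and> (\<forall>x. q x > 0) \<and>
     bounded_op q q (kernel_op Q) \<and>
     (\<forall>f\<in>l2 q. kernel_op Q (kernel_op (time_reversal q Q) f) =
                kernel_op (time_reversal q Q) (kernel_op Q f))"

definition l2_inverse ::
  "('b \<Rightarrow> real) \<Rightarrow> (('b \<Rightarrow> complex) \<Rightarrow> ('a \<Rightarrow> complex)) \<Rightarrow> ('a \<Rightarrow> complex) \<Rightarrow> ('b \<Rightarrow> complex)" where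
  "l2_inverse q \<Lambda> = inv_into (l2 q) \<Lambda>"

definition similar_kernels ::
  "('a \<Rightarrow> real) \<Rightarrow> ('a \<Rightarrow> 'a \<Rightarrow> real) \<Rightarrow> (('a \<Rightarrow> complex) \<Rightarrow> ('a \<Rightarrow> complex)) \<Rightarrow>
   ('a \<Rightarrow> real) \<Rightarrow> ('a \<Rightarrow> 'a \<Rightarrow> real) \<Rightarrow> bool" where
  "similar_kernels p P \<Lambda> q Q \<longleftrightarrow>
     bounded_op q p \<Lambda> \<and> bij_betw \<Lambda> (l2 q) (l2 p) \<and> bounded_op p q (l2_inverse q \<Lambda>) \<and>
     (\<forall>f\<in>l2 q. kernel_op P (\<Lambda> f) = \<Lambda> (kernel_op Q f))"

definition condition_number ::
  "('a \<Rightarrow> real) \<Rightarrow> ('b \<Rightarrow> real) \<Rightarrow> (('b \<Rightarrow> complex) \<Rightarrow> ('a \<Rightarrow> complex)) \<Rightarrow> real" where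
  "condition_number p q \<Lambda> = op_norm q p \<Lambda> * op_norm p q (l2_inverse q \<Lambda>)"

section \<open>Convergence rates\<close>

text \<open>
  For an ergodic kernel with compact operator, \<open>lambda_star\<close> is the supremum of \<open>cmod z\<close>
  over the spectral values \<open>z \<noteq> 1\<close> on \<open>l2 \<pi>\<close>. The restriction to \<open>l2_0 \<pi>\<close> is the
  formulation that also counts multiplicity: \<open>P\<close> times its time-reversal may be reducible
  even though \<open>P\<close> is ergodic, and then its second largest eigenvalue is again 1.
\<close>

definition lambda_star :: "('a \<Rightarrow> real) \<Rightarrow> (('a \<Rightarrow> complex) \<Rightarrow> ('a \<Rightarrow> complex)) \<Rightarrow> real" where
  "lambda_star \<pi> T = spectral_radius_on \<pi> (l2_0 \<pi>) T"

definition sigma_star :: "('a \<Rightarrow> real) \<Rightarrow> ('a \<Rightarrow> 'a \<Rightarrow> real) \<Rightarrow> real" where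
  "sigma_star \<pi> P = sqrt (lambda_star \<pi> (kernel_op P \<circ> kernel_op (time_reversal \<pi> P)))"

definition pow_minus_stationary ::
  "('a \<Rightarrow> real) \<Rightarrow> ('a \<Rightarrow> 'a \<Rightarrow> real) \<Rightarrow> nat \<Rightarrow> ('a \<Rightarrow> complex) \<Rightarrow> ('a \<Rightarrow> complex)" where
  "pow_minus_stationary \<pi> P n f =
     (\<lambda>x. kernel_op (kernel_pow P n) f x - (\<Sum>\<^sub>\<infinity>y. f y * of_real (\<pi> y)))"

text \<open>
  The threshold is the ceiling of \<open>ln kap / (ln sig - ln lam)\<close>, read as infinity when
  \<open>lam = sig\<close> (HOL would evaluate the quotient to 0). The case \<open>lam = 0 < sig\<close> does not
  arise for a compact kernel similar to a normal one.
\<close>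

definition n_star :: "real \<Rightarrow> real \<Rightarrow> real \<Rightarrow> enat" where
  "n_star kap sig lam = (if lam < sig then enat (nat \<lceil>ln kap / (ln sig - ln lam)\<rceil>) else \<infinity>)"

definition total_variation :: "('a \<Rightarrow> real) \<Rightarrow> ('a \<Rightarrow> real) \<Rightarrow> real" where
  "total_variation \<mu> \<nu> = (\<Sum>\<^sub>\<infinity>x. \<bar>\<mu> x - \<nu> x\<bar>) / 2"

text \<open>Used for finite state spaces only, where the maxima and minima exist.\<close>

definition tv_distance :: "('a \<Rightarrow> real) \<Rightarrow> ('a \<Rightarrow> 'a \<Rightarrow> real) \<Rightarrow> nat \<Rightarrow> real" where
  "tv_distance \<pi> P n = Max (range (\<lambda>x. total_variation (kernel_pow P n x) \<pi>))"

definition min_prob :: "('a \<Rightarrow> real) \<Rightarrow> real" where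
  "min_prob \<pi> = Min (range \<pi>)"

text \<open>
  The sufficient condition for \<open>lambda_star < sigma_star\<close> uses the largest diagonal entry of
  \<open>P - \<pi>\<close>, not of \<open>P\<close>: with \<open>P i i\<close> in place of \<open>P i i - \<pi> i\<close> it would be false, since
  if every row of \<open>P\<close> is \<open>\<pi>\<close> then \<open>lambda_star = sigma_star = 0 < P i i\<close>.
\<close>

definition max_centered_diagonal :: "('a \<Rightarrow> real) \<Rightarrow> ('a \<Rightarrow> 'a \<Rightarrow> real) \<Rightarrow> real" where
  "max_centered_diagonal \<pi> P = Max (range (\<lambda>i. P i i - \<pi> i))"

end

theory Submission
  imports Defs
begin

text \<open>
  The analytic core is that a compact normal operator on a Hilbert space has an eigenvalue
  whose modulus is the norm of the operator (\<open>normal_eigenvector\<close>). It is applied twice: to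
  \<open>P\<close> times its time-reversal on the functions of mean zero, where the eigenvalue is
  \<open>sigma_star\<close> squared, and to \<open>Q\<close> on a reducing subspace of codimension one, where its modulus
  turns out to be \<open>lambda_star\<close>.

  Since \<open>P\<close> fixes the constants and preserves the mean, the norm of \<open>P^n - \<pi>\<close> is the norm of
  \<open>P^n\<close> on the functions of mean zero. On that space the adjoint \<open>P*\<close> is the time-reversal, and
  \<open>\<parallel>P\<parallel>^2 = \<parallel>P*\<parallel>^2 \<le> \<parallel>P P*\<parallel>\<close>. The last norm is the spectral radius of \<open>P P*\<close>, which gives the
  bound by powers of \<open>sigma_star\<close>.

  For the other bound put \<open>e = \<Lambda>^(-1) 1\<close>. Then \<open>Q e = e\<close>, hence \<open>Q* e = e\<close> by normality, and the
  orthogonal complement \<open>W\<close> of \<open>e\<close> is invariant under \<open>Q\<close> and \<open>Q*\<close>. The restriction of \<open>Q\<close> to \<open>W\<close> is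
  compact because \<open>Q = \<Lambda>^(-1) P \<Lambda>\<close>, so it has an eigenfunction \<open>k\<close> with eigenvalue \<open>z\<close> such that
  \<open>\<parallel>Q^n w\<parallel> \<le> \<bar>z\<bar>^n \<parallel>w\<parallel>\<close> on \<open>W\<close>. Its image \<open>\<Lambda> k\<close> is an eigenfunction of \<open>P\<close>. An eigenfunction of an ergodic
  kernel with \<open>\<bar>z\<bar> \<ge> 1\<close> is constant (\<open>peripheral_eigenfunction\<close>), and \<open>\<Lambda> k\<close> is not a multiple of
  \<open>1 = \<Lambda> e\<close>; therefore \<open>\<bar>z\<bar> < 1\<close>, and \<open>\<Lambda> k\<close> has mean zero. If \<open>f = \<Lambda> (c e + w)\<close> has mean zero, with
  \<open>w\<close> in \<open>W\<close>, then \<open>0 = c +\<close> the mean of \<open>\<Lambda> (Q^n w)\<close>, which tends to \<open>c\<close>; so \<open>c = 0\<close> and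
  \<open>\<parallel>P^n f\<parallel> = \<parallel>\<Lambda> (Q^n w)\<parallel> \<le> kap \<bar>z\<bar>^n \<parallel>f\<parallel>\<close>. By the Neumann series this growth excludes spectrum of modulus
  above \<open>\<bar>z\<bar>\<close>, while \<open>\<Lambda> k\<close> puts \<open>z\<close> into the spectrum: \<open>lambda_star = \<bar>z\<bar>\<close>. The same eigenfunction
  gives the lower bound \<open>lambda_star^n\<close>.

  The total variation bound follows by testing \<open>P^n - \<pi>\<close> on a function with values \<open>1\<close> and \<open>-1\<close> and
  evaluating the result at a point, a functional of norm \<open>sqrt (1 / \<pi> x - 1)\<close> on the functions of
  mean zero. The diagonal entries of \<open>P - \<pi>\<close> are Rayleigh quotients and so are bounded by its norm.
  Finally \<open>lambda_star = 0\<close> forces \<open>P = \<pi>\<close> and \<open>sigma_star = 0\<close>, so that the threshold \<open>n_star\<close> never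
  meets the logarithm of zero.
\<close>

section \<open>The weighted Hilbert space\<close>

locale pos_weight =
  fixes p :: "'a \<Rightarrow> real"
  assumes weight_pos: "p x > 0"
begin

lemma mem_l2_iff: "f \<in> l2 p \<longleftrightarrow> (\<lambda>x. (cmod (f x))\<^sup>2 * p x) summable_on UNIV"
  by (simp add: l2_def)

lemma term_nonneg: "0 \<le> (cmod (f x))\<^sup>2 * p x"
  using weight_pos[of x] by simp

lemma norm_nonneg [simp]: "0 \<le> l2_norm p f"
  unfolding l2_norm_def by (intro real_sqrt_ge_zero infsum_nonneg term_nonneg)

lemma norm_power2: "(l2_norm p f)\<^sup>2 = (\<Sum>\<^sub>\<infinity>x. (cmod (f x))\<^sup>2 * p x)"
  unfolding l2_norm_def by (intro real_sqrt_pow2 infsum_nonneg term_nonneg)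

text \<open>
  A uniform bound on finite partial sums gives membership and the norm bound at once. It serves
  where a candidate function is only known pointwise: as a limit, or as the image under an operator
  that is not yet known to be bounded.
\<close>

lemma l2_of_finite_bound:
  assumes "C \<ge> 0" "\<And>F. finite F \<Longrightarrow> (\<Sum>x\<in>F. (cmod (f x))\<^sup>2 * p x) \<le> C\<^sup>2"
  shows "f \<in> l2 p" "l2_norm p f \<le> C"
proof -
  show *: "f \<in> l2 p" unfolding mem_l2_iff
    using assms(2) by (intro nonneg_bdd_above_summable_on term_nonneg bdd_aboveI2) auto
  have "(l2_norm p f)\<^sup>2 \<le> C\<^sup>2" unfolding norm_power2
    using * assms(2) by (intro infsum_le_finite_sums) (auto simp: mem_l2_iff)
  then show "l2_norm p f \<le> C" using assms(1) by (rule power2_le_imp_le)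
qed

lemma finite_sum_le_norm:
  assumes "f \<in> l2 p" "finite F"
  shows "(\<Sum>x\<in>F. (cmod (f x))\<^sup>2 * p x) \<le> (l2_norm p f)\<^sup>2"
  unfolding norm_power2 using assms
  by (intro finite_sum_le_infsum) (auto simp: mem_l2_iff intro: term_nonneg)

lemma pointwise_le_norm:
  assumes "f \<in> l2 p"
  shows "cmod (f x) * sqrt (p x) \<le> l2_norm p f"
proof (rule power2_le_imp_le)
  have "(cmod (f x))\<^sup>2 * p x \<le> (l2_norm p f)\<^sup>2"
    using finite_sum_le_norm[OF assms, of "{x}"] by simp
  then show "(cmod (f x) * sqrt (p x))\<^sup>2 \<le> (l2_norm p f)\<^sup>2"
    using weight_pos[of x] by (simp add: power_mult_distrib)
qed simp

lemma norm_eq_0_imp: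
  assumes "f \<in> l2 p" "l2_norm p f = 0"
  shows "f = (\<lambda>_. 0)"
proof
  fix x show "f x = 0"
    using pointwise_le_norm[OF assms(1), of x] assms(2) weight_pos[of x]
    by (simp add: mult_le_0_iff)
qed

lemma norm_pos: "f \<in> l2 p \<Longrightarrow> f \<noteq> (\<lambda>_. 0) \<Longrightarrow> l2_norm p f > 0"
  using norm_eq_0_imp norm_nonneg by (metis order_le_less)

lemma zero_mem: "(\<lambda>_. 0) \<in> l2 p"
  by (simp add: mem_l2_iff)

lemma norm_zero [simp]: "l2_norm p (\<lambda>_. 0) = 0"
  by (simp add: l2_norm_def)

lemma lincomb_mem:
  assumes "f \<in> l2 p" "g \<in> l2 p"
  shows "(\<lambda>x. a * f x + b * g x) \<in> l2 p"
proof -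
  have "(\<lambda>x. 2 * (cmod a)\<^sup>2 * ((cmod (f x))\<^sup>2 * p x) + 2 * (cmod b)\<^sup>2 * ((cmod (g x))\<^sup>2 * p x))
      summable_on UNIV"
    using assms by (intro summable_on_add summable_on_cmult_right) (auto simp: mem_l2_iff)
  then show ?thesis unfolding mem_l2_iff
  proof (rule summable_on_comparison_test)
    fix x
    have "cmod (a * f x + b * g x) \<le> cmod a * cmod (f x) + cmod b * cmod (g x)"
      by (metis norm_mult norm_triangle_ineq)
    then have "(cmod (a * f x + b * g x))\<^sup>2 \<le> (cmod a * cmod (f x) + cmod b * cmod (g x))\<^sup>2"
      by (intro power_mono) auto
    also have "\<dots> \<le> 2 * (cmod a * cmod (f x))\<^sup>2 + 2 * (cmod b * cmod (g x))\<^sup>2"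
      using sum_squares_bound[of "cmod a * cmod (f x)" "cmod b * cmod (g x)"]
      by (simp add: power2_sum)
    finally have "(cmod (a * f x + b * g x))\<^sup>2 * p x
        \<le> (2 * (cmod a * cmod (f x))\<^sup>2 + 2 * (cmod b * cmod (g x))\<^sup>2) * p x"
      using weight_pos[of x] by (intro mult_right_mono) auto
    then show "(cmod (a * f x + b * g x))\<^sup>2 * p x
        \<le> 2 * (cmod a)\<^sup>2 * ((cmod (f x))\<^sup>2 * p x) + 2 * (cmod b)\<^sup>2 * ((cmod (g x))\<^sup>2 * p x)"
      by (simp add: power_mult_distrib algebra_simps)
  qed (rule term_nonneg)
qed

lemma scale_mem: "f \<in> l2 p \<Longrightarrow> (\<lambda>x. a * f x) \<in> l2 p"
  using lincomb_mem[of f f a 0] by simp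

lemma diff_mem: "f \<in> l2 p \<Longrightarrow> g \<in> l2 p \<Longrightarrow> (\<lambda>x. f x - g x) \<in> l2 p"
  using lincomb_mem[of f g 1 "-1"] by simp

lemma norm_scale: "l2_norm p (\<lambda>x. a * f x) = cmod a * l2_norm p f"
  unfolding l2_norm_def
  by (simp add: norm_mult power_mult_distrib mult.assoc infsum_cmult_right' real_sqrt_mult)

lemma norm_minus_commute: "l2_norm p (\<lambda>x. f x - g x) = l2_norm p (\<lambda>x. g x - f x)"
  unfolding l2_norm_def by (simp add: norm_minus_commute)

lemma inner_abs_summable:
  assumes "f \<in> l2 p" "g \<in> l2 p"
  shows "(\<lambda>x. norm (f x * cnj (g x) * of_real (p x))) summable_on UNIV"
proof (rule summable_on_comparison_test)
  show "(\<lambda>x. (cmod (f x))\<^sup>2 * p x + (cmod (g x))\<^sup>2 * p x) summable_on UNIV"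
    using assms by (intro summable_on_add) (auto simp: mem_l2_iff)
  fix x
  have "cmod (f x) * cmod (g x) \<le> (cmod (f x))\<^sup>2 + (cmod (g x))\<^sup>2"
    using sum_squares_bound[of "cmod (f x)" "cmod (g x)"]
      zero_le_power2[of "cmod (f x)"] zero_le_power2[of "cmod (g x)"]
      mult_nonneg_nonneg[OF norm_ge_zero[of "f x"] norm_ge_zero[of "g x"]] by linarith
  then have "cmod (f x) * cmod (g x) * p x \<le> ((cmod (f x))\<^sup>2 + (cmod (g x))\<^sup>2) * p x"
    using weight_pos[of x] by (intro mult_right_mono) auto
  then show "cmod (f x * cnj (g x) * of_real (p x)) \<le> (cmod (f x))\<^sup>2 * p x + (cmod (g x))\<^sup>2 * p x"
    using weight_pos[of x] by (simp add: norm_mult algebra_simps)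
qed simp

lemmas inner_summable = abs_summable_summable[OF inner_abs_summable]

lemma inner_lincomb_left:
  assumes "f \<in> l2 p" "g \<in> l2 p" "h \<in> l2 p"
  shows "l2_inner p (\<lambda>x. a * f x + b * g x) h = a * l2_inner p f h + b * l2_inner p g h"
proof -
  have "l2_inner p (\<lambda>x. a * f x + b * g x) h
      = (\<Sum>\<^sub>\<infinity>x. a * (f x * cnj (h x) * of_real (p x)) + b * (g x * cnj (h x) * of_real (p x)))"
    unfolding l2_inner_def by (intro infsum_cong) (simp add: algebra_simps)
  also have "\<dots> = a * l2_inner p f h + b * l2_inner p g h"
    unfolding l2_inner_def using assms
    by (subst infsum_add) (auto intro!: summable_on_cmult_right inner_summable
        simp: infsum_cmult_right')
  finally show ?thesis .
qed

lemma inner_commute: "l2_inner p g f = cnj (l2_inner p f g)"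
  unfolding l2_inner_def by (simp flip: infsum_cnj add: mult.commute mult.left_commute)

lemma inner_lincomb_right:
  assumes "f \<in> l2 p" "g \<in> l2 p" "h \<in> l2 p"
  shows "l2_inner p h (\<lambda>x. a * f x + b * g x) = cnj a * l2_inner p h f + cnj b * l2_inner p h g"
  using inner_lincomb_left[OF assms, of a b]
  by (subst (1 2 3) inner_commute) simp

lemma inner_scale_left: "l2_inner p (\<lambda>x. a * f x) h = a * l2_inner p f h"
  unfolding l2_inner_def by (simp add: mult.assoc infsum_cmult_right')

lemma inner_scale_right: "l2_inner p h (\<lambda>x. a * f x) = cnj a * l2_inner p h f"
  by (subst (1 2) inner_commute) (simp add: inner_scale_left)

lemma inner_diff_left:
  "f \<in> l2 p \<Longrightarrow> g \<in> l2 p \<Longrightarrow> h \<in> l2 p \<Longrightarrow>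
   l2_inner p (\<lambda>x. f x - g x) h = l2_inner p f h - l2_inner p g h"
  using inner_lincomb_left[of f g h 1 "-1"] by simp

lemma inner_zero_left [simp]: "l2_inner p (\<lambda>_. 0) h = 0"
  by (simp add: l2_inner_def)

lemma inner_self:
  assumes "f \<in> l2 p"
  shows "l2_inner p f f = of_real ((l2_norm p f)\<^sup>2)"
proof -
  have "l2_inner p f f = (\<Sum>\<^sub>\<infinity>x. of_real ((cmod (f x))\<^sup>2 * p x))"
    unfolding l2_inner_def
    by (intro infsum_cong) (simp add: complex_norm_square del: of_real_power)
  also have "\<dots> = of_real ((l2_norm p f)\<^sup>2)"
    unfolding norm_power2 using assms
    by (intro infsumI has_sum_of_real has_sum_infsum) (simp add: mem_l2_iff)
  finally show ?thesis .
qed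

lemma norm_lincomb_power2:
  assumes "f \<in> l2 p" "g \<in> l2 p"
  shows "(l2_norm p (\<lambda>x. a * f x + b * g x))\<^sup>2 =
    (cmod a)\<^sup>2 * (l2_norm p f)\<^sup>2 + (cmod b)\<^sup>2 * (l2_norm p g)\<^sup>2 + 2 * Re (a * cnj b * l2_inner p f g)"
proof -
  let ?h = "\<lambda>x. a * f x + b * g x"
  have h: "?h \<in> l2 p" using assms by (rule lincomb_mem)
  have "l2_inner p ?h ?h = a * (cnj a * l2_inner p f f + cnj b * l2_inner p f g)
      + b * (cnj a * l2_inner p g f + cnj b * l2_inner p g g)"
    using assms h by (simp add: inner_lincomb_left inner_lincomb_right)
  also have "\<dots> = (a * cnj a) * l2_inner p f f + (b * cnj b) * l2_inner p g g
      + (a * cnj b * l2_inner p f g + cnj (a * cnj b * l2_inner p f g))"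
    by (simp add: inner_commute[of g f] algebra_simps)
  also have "\<dots> = of_real ((cmod a)\<^sup>2 * (l2_norm p f)\<^sup>2 + (cmod b)\<^sup>2 * (l2_norm p g)\<^sup>2
      + 2 * Re (a * cnj b * l2_inner p f g))"
    by (simp only: inner_self assms complex_add_cnj complex_norm_square[symmetric] of_real_add
        of_real_mult)
  finally show ?thesis unfolding inner_self[OF h] of_real_eq_iff .
qed

lemma Cauchy_Schwarz:
  assumes "f \<in> l2 p" "g \<in> l2 p"
  shows "cmod (l2_inner p f g) \<le> l2_norm p f * l2_norm p g"
proof (cases "l2_norm p g = 0")
  case True
  then show ?thesis using norm_eq_0_imp[OF assms(2)] by (simp add: l2_inner_def)
next
  case False
  define r where "r = (l2_norm p g)\<^sup>2"
  define c where "c = l2_inner p f g"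
  have r: "r > 0" using False by (simp add: r_def)
  \<comment> \<open>The square norm of r f - c g, a multiple of the component of f orthogonal to g.\<close>
  have "0 \<le> (l2_norm p (\<lambda>x. of_real r * f x + (- c) * g x))\<^sup>2" by simp
  also have "\<dots> = r\<^sup>2 * (l2_norm p f)\<^sup>2 + (cmod c)\<^sup>2 * r - 2 * Re (r * (c * cnj c))"
    unfolding norm_lincomb_power2[OF assms] c_def[symmetric] r_def[symmetric]
    by (simp add: algebra_simps)
  also have "\<dots> = r * (r * (l2_norm p f)\<^sup>2 - (cmod c)\<^sup>2)"
    by (simp add: complex_norm_square[symmetric] algebra_simps power2_eq_square del: of_real_mult)
  finally have "(cmod c)\<^sup>2 \<le> (l2_norm p f * l2_norm p g)\<^sup>2"
    using r by (simp add: zero_le_mult_iff power_mult_distrib r_def mult.commute)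
  then show ?thesis unfolding c_def by (rule power2_le_imp_le) simp
qed

lemma norm_add_le:
  assumes "f \<in> l2 p" "g \<in> l2 p"
  shows "l2_norm p (\<lambda>x. f x + g x) \<le> l2_norm p f + l2_norm p g"
proof (rule power2_le_imp_le)
  have "Re (l2_inner p f g) \<le> l2_norm p f * l2_norm p g"
    using Cauchy_Schwarz[OF assms] complex_Re_le_cmod order_trans by blast
  then show "(l2_norm p (\<lambda>x. f x + g x))\<^sup>2 \<le> (l2_norm p f + l2_norm p g)\<^sup>2"
    using norm_lincomb_power2[OF assms, of 1 1] by (simp add: power2_sum)
qed simp

lemma norm_diff_le:
  assumes "f \<in> l2 p" "g \<in> l2 p"
  shows "l2_norm p (\<lambda>x. f x - g x) \<le> l2_norm p f + l2_norm p g"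
  using norm_add_le[OF assms(1) scale_mem[OF assms(2), of "-1"]] norm_scale[of "-1" g] by simp

lemma norm_triangle_sub:
  assumes "f \<in> l2 p" "g \<in> l2 p"
  shows "l2_norm p f \<le> l2_norm p g + l2_norm p (\<lambda>x. f x - g x)"
  using norm_add_le[OF assms(2) diff_mem[OF assms]] by simp

text \<open>
  The weight of every point is positive, so a Cauchy sequence converges pointwise, and the
  pointwise limit is also the limit in norm because the Cauchy estimate on finite partial sums
  passes to the limit.
\<close>

lemma complete:
  assumes f: "\<And>n. f n \<in> l2 p"
    and Cau: "\<And>e. e > 0 \<Longrightarrow> \<exists>M. \<forall>m\<ge>M. \<forall>n\<ge>M. l2_norm p (\<lambda>x. f m x - f n x) \<le> e"
  shows "\<exists>g\<in>l2 p. (\<lambda>n. l2_norm p (\<lambda>x. f n x - g x)) \<longlonglongrightarrow> 0"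
proof -
  have "\<exists>l. (\<lambda>n. f n x) \<longlonglongrightarrow> l" for x
  proof -
    have "Cauchy (\<lambda>n. f n x)"
    proof (rule metric_CauchyI)
      fix e :: real assume e: "e > 0"
      obtain M where M: "\<And>m n. m \<ge> M \<Longrightarrow> n \<ge> M \<Longrightarrow>
          l2_norm p (\<lambda>x. f m x - f n x) \<le> e * sqrt (p x) / 2"
        using Cau[of "e * sqrt (p x) / 2"] e weight_pos[of x] by auto
      have "dist (f m x) (f n x) < e" if "m \<ge> M" "n \<ge> M" for m n
      proof -
        have "cmod (f m x - f n x) * sqrt (p x) \<le> e / 2 * sqrt (p x)"
          using pointwise_le_norm[OF diff_mem[OF f[of m] f[of n]], of x] M[OF that] by simp
        then show ?thesis using e weight_pos[of x] by (simp add: dist_norm)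
      qed
      then show "\<exists>M. \<forall>m\<ge>M. \<forall>n\<ge>M. dist (f m x) (f n x) < e" by blast
    qed
    then show ?thesis using Cauchy_convergent convergent_def by blast
  qed
  then obtain g where g: "\<And>x. (\<lambda>n. f n x) \<longlonglongrightarrow> g x" by metis
  have close: "\<exists>M. \<forall>n\<ge>M. (\<lambda>x. f n x - g x) \<in> l2 p \<and> l2_norm p (\<lambda>x. f n x - g x) \<le> e"
    if e: "e > 0" for e
  proof -
    obtain M where M: "\<And>m n. m \<ge> M \<Longrightarrow> n \<ge> M \<Longrightarrow> l2_norm p (\<lambda>x. f m x - f n x) \<le> e"
      using Cau[OF e] by auto
    have "(\<lambda>x. f n x - g x) \<in> l2 p \<and> l2_norm p (\<lambda>x. f n x - g x) \<le> e" if n: "n \<ge> M" for n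
    proof -
      have "(\<Sum>x\<in>F. (cmod (f n x - g x))\<^sup>2 * p x) \<le> e\<^sup>2" if F: "finite F" for F
      proof (rule LIMSEQ_le_const2)
        show "(\<lambda>m. \<Sum>x\<in>F. (cmod (f n x - f m x))\<^sup>2 * p x) \<longlonglongrightarrow> (\<Sum>x\<in>F. (cmod (f n x - g x))\<^sup>2 * p x)"
          by (intro tendsto_intros g)
        show "\<exists>N. \<forall>m\<ge>N. (\<Sum>x\<in>F. (cmod (f n x - f m x))\<^sup>2 * p x) \<le> e\<^sup>2"
        proof (intro exI allI impI)
          fix m assume "m \<ge> M"
          have "(\<Sum>x\<in>F. (cmod (f n x - f m x))\<^sup>2 * p x) \<le> (l2_norm p (\<lambda>x. f n x - f m x))\<^sup>2"
            using diff_mem[OF f f] F by (rule finite_sum_le_norm)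
          also have "\<dots> \<le> e\<^sup>2" using M[OF n \<open>m \<ge> M\<close>] by (intro power_mono) auto
          finally show "(\<Sum>x\<in>F. (cmod (f n x - f m x))\<^sup>2 * p x) \<le> e\<^sup>2" .
        qed
      qed
      then show ?thesis using l2_of_finite_bound[of e "\<lambda>x. f n x - g x"] e by auto
    qed
    then show ?thesis by blast
  qed
  obtain n where "(\<lambda>x. f n x - g x) \<in> l2 p" using close[of 1] by auto
  from diff_mem[OF f[of n] this] have "g \<in> l2 p" by simp
  moreover have "(\<lambda>n. l2_norm p (\<lambda>x. f n x - g x)) \<longlonglongrightarrow> 0"
  proof (rule LIMSEQ_I)
    fix r :: real assume "r > 0"
    then obtain M where M: "\<And>n. n \<ge> M \<Longrightarrow> l2_norm p (\<lambda>x. f n x - g x) \<le> r / 2"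
      using close[of "r / 2"] by auto
    have "norm (l2_norm p (\<lambda>x. f n x - g x) - 0) < r" if "n \<ge> M" for n
      using M[OF that] \<open>r > 0\<close> by simp
    then show "\<exists>no. \<forall>n\<ge>no. norm (l2_norm p (\<lambda>x. f n x - g x) - 0) < r" by blast
  qed
  ultimately show ?thesis by blast
qed

lemma limit_unique:
  assumes "\<And>n. f n \<in> l2 p" "g \<in> l2 p" "h \<in> l2 p"
    and "(\<lambda>n. l2_norm p (\<lambda>x. f n x - g x)) \<longlonglongrightarrow> 0" "(\<lambda>n. l2_norm p (\<lambda>x. f n x - h x)) \<longlonglongrightarrow> 0"
  shows "g = h"
proof -
  have "l2_norm p (\<lambda>x. g x - h x) \<le> l2_norm p (\<lambda>x. f n x - g x) + l2_norm p (\<lambda>x. f n x - h x)" for n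
    using norm_diff_le[OF diff_mem diff_mem, of "f n" h "f n" g] assms(1-3) by (simp add: add.commute)
  moreover have "(\<lambda>n. l2_norm p (\<lambda>x. f n x - g x) + l2_norm p (\<lambda>x. f n x - h x)) \<longlonglongrightarrow> 0 + 0"
    using assms by (intro tendsto_add)
  ultimately have "l2_norm p (\<lambda>x. g x - h x) \<le> 0"
    by (intro LIMSEQ_le_const[where X = "\<lambda>n. l2_norm p (\<lambda>x. f n x - g x) + l2_norm p (\<lambda>x. f n x - h x)"]) auto
  then have "(\<lambda>x. g x - h x) = (\<lambda>_. 0)"
    using norm_eq_0_imp[OF diff_mem[OF assms(2,3)]] norm_nonneg antisym by blast
  then show ?thesis by (metis eq_iff_diff_eq_0 ext)
qed

lemma indicator_mem: "(\<lambda>x. if x = y then 1 else 0) \<in> l2 p"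
  unfolding mem_l2_iff by (rule finite_nonzero_values_imp_summable_on) simp

section \<open>Bounded operators on closed subspaces\<close>

text \<open>
  Closedness is sequential, in the form in which limits are produced by compactness arguments.
\<close>

definition closed_subspace :: "('a \<Rightarrow> complex) set \<Rightarrow> bool" where
  "closed_subspace W \<longleftrightarrow> W \<subseteq> l2 p \<and> (\<lambda>_. 0) \<in> W \<and>
     (\<forall>f\<in>W. \<forall>g\<in>W. \<forall>a b. (\<lambda>x. a * f x + b * g x) \<in> W) \<and>
     (\<forall>f g. (\<forall>n. f n \<in> W) \<longrightarrow> g \<in> l2 p \<longrightarrow>
        (\<lambda>n. l2_norm p (\<lambda>x. f n x - g x)) \<longlonglongrightarrow> 0 \<longrightarrow> g \<in> W)"

definition bounded_on :: "('a \<Rightarrow> complex) set \<Rightarrow> (('a \<Rightarrow> complex) \<Rightarrow> ('a \<Rightarrow> complex)) \<Rightarrow> bool" where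
  "bounded_on W T \<longleftrightarrow> (\<forall>f\<in>W. T f \<in> W) \<and>
     (\<forall>f\<in>W. \<forall>g\<in>W. \<forall>a b. T (\<lambda>x. a * f x + b * g x) = (\<lambda>x. a * T f x + b * T g x)) \<and>
     (\<exists>C. \<forall>f\<in>W. l2_norm p (T f) \<le> C * l2_norm p f)"

definition norm_on :: "('a \<Rightarrow> complex) set \<Rightarrow> (('a \<Rightarrow> complex) \<Rightarrow> ('a \<Rightarrow> complex)) \<Rightarrow> real" where
  "norm_on W T = (SUP f\<in>{f \<in> W. l2_norm p f \<le> 1}. l2_norm p (T f))"

text \<open>
  The limits are asked to lie in the subspace, so that the notion refers to \<open>W\<close> as a space of its own.
\<close>

definition compact_on :: "('a \<Rightarrow> complex) set \<Rightarrow> (('a \<Rightarrow> complex) \<Rightarrow> ('a \<Rightarrow> complex)) \<Rightarrow> bool" where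
  "compact_on W T \<longleftrightarrow> (\<forall>f :: nat \<Rightarrow> _. (\<forall>n. f n \<in> W \<and> l2_norm p (f n) \<le> 1) \<longrightarrow>
     (\<exists>g\<in>W. \<exists>r. strict_mono r \<and> (\<lambda>n. l2_norm p (\<lambda>x. T (f (r n)) x - g x)) \<longlonglongrightarrow> 0))"

lemma closed_subspaceD:
  assumes "closed_subspace W"
  shows "f \<in> W \<Longrightarrow> f \<in> l2 p" "(\<lambda>_. 0) \<in> W"
    "f \<in> W \<Longrightarrow> g \<in> W \<Longrightarrow> (\<lambda>x. a * f x + b * g x) \<in> W"
    "f \<in> W \<Longrightarrow> (\<lambda>x. a * f x) \<in> W"
    "f \<in> W \<Longrightarrow> g \<in> W \<Longrightarrow> (\<lambda>x. f x - g x) \<in> W"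
    "f \<in> W \<Longrightarrow> g \<in> W \<Longrightarrow> (\<lambda>x. f x + g x) \<in> W"
    "(\<And>n. u n \<in> W) \<Longrightarrow> g \<in> l2 p \<Longrightarrow>
       (\<lambda>n. l2_norm p (\<lambda>x. u n x - g x)) \<longlonglongrightarrow> 0 \<Longrightarrow> g \<in> W"
proof -
  show lin: "f \<in> W \<Longrightarrow> g \<in> W \<Longrightarrow> (\<lambda>x. a * f x + b * g x) \<in> W" for f g a b
    using assms unfolding closed_subspace_def by blast
  show "f \<in> W \<Longrightarrow> (\<lambda>x. a * f x) \<in> W" using lin[of f f a 0] by simp
  show "f \<in> W \<Longrightarrow> g \<in> W \<Longrightarrow> (\<lambda>x. f x - g x) \<in> W" using lin[of f g 1 "-1"] by simp
  show "f \<in> W \<Longrightarrow> g \<in> W \<Longrightarrow> (\<lambda>x. f x + g x) \<in> W" using lin[of f g 1 1] by simp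
qed (use assms in \<open>unfold closed_subspace_def, blast+\<close>)

lemma bounded_onD:
  assumes "bounded_on W T"
  shows "f \<in> W \<Longrightarrow> T f \<in> W"
    "f \<in> W \<Longrightarrow> g \<in> W \<Longrightarrow> T (\<lambda>x. a * f x + b * g x) = (\<lambda>x. a * T f x + b * T g x)"
    "f \<in> W \<Longrightarrow> T (\<lambda>x. a * f x) = (\<lambda>x. a * T f x)"
    "f \<in> W \<Longrightarrow> g \<in> W \<Longrightarrow> T (\<lambda>x. f x - g x) = (\<lambda>x. T f x - T g x)"
    "f \<in> W \<Longrightarrow> g \<in> W \<Longrightarrow> T (\<lambda>x. f x + g x) = (\<lambda>x. T f x + T g x)"
proof -
  show lin: "f \<in> W \<Longrightarrow> g \<in> W \<Longrightarrow> T (\<lambda>x. a * f x + b * g x) = (\<lambda>x. a * T f x + b * T g x)" for f g a b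
    using assms unfolding bounded_on_def by blast
  show "f \<in> W \<Longrightarrow> T (\<lambda>x. a * f x) = (\<lambda>x. a * T f x)" using lin[of f f a 0] by simp
  show "f \<in> W \<Longrightarrow> g \<in> W \<Longrightarrow> T (\<lambda>x. f x - g x) = (\<lambda>x. T f x - T g x)" using lin[of f g 1 "-1"] by simp
  show "f \<in> W \<Longrightarrow> g \<in> W \<Longrightarrow> T (\<lambda>x. f x + g x) = (\<lambda>x. T f x + T g x)" using lin[of f g 1 1] by simp
qed (use assms in \<open>unfold bounded_on_def, blast\<close>)

lemma bounded_on_obtain:
  assumes "bounded_on W T"
  obtains C where "C \<ge> 0" "\<And>f. f \<in> W \<Longrightarrow> l2_norm p (T f) \<le> C * l2_norm p f"
proof -
  obtain C where C: "\<forall>f\<in>W. l2_norm p (T f) \<le> C * l2_norm p f"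
    using assms unfolding bounded_on_def by blast
  have "l2_norm p (T f) \<le> max C 0 * l2_norm p f" if "f \<in> W" for f
    using C that by (meson max.cobounded1 mult_right_mono norm_nonneg order_trans)
  then show thesis using that[of "max C 0"] by simp
qed

text \<open>
  By homogeneity the values on the unit ball control all values. Keeping the functional \<open>\<Phi>\<close> abstract
  serves operators within one space and operators between two differently weighted spaces alike.
\<close>

lemma unit_ball_supremum:
  assumes W: "closed_subspace W"
    and hom: "\<And>f a. f \<in> W \<Longrightarrow> \<Phi> (\<lambda>x. a * f x) = cmod a * \<Phi> f"
    and bound: "\<And>f. f \<in> W \<Longrightarrow> \<Phi> f \<le> C * l2_norm p f"
  shows "bdd_above (\<Phi> ` {f \<in> W. l2_norm p f \<le> 1})"
    and unit_ball_le: "f \<in> W \<Longrightarrow> \<Phi> f \<le> (SUP f\<in>{f \<in> W. l2_norm p f \<le> 1}. \<Phi> f) * l2_norm p f"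
    and "0 \<le> (SUP f\<in>{f \<in> W. l2_norm p f \<le> 1}. \<Phi> f)"
proof -
  let ?B = "{f \<in> W. l2_norm p f \<le> 1}"
  show bdd: "bdd_above (\<Phi> ` ?B)"
  proof (rule bdd_aboveI2)
    fix f assume f: "f \<in> ?B"
    have "C * l2_norm p f \<le> \<bar>C\<bar> * 1" using f by (intro mult_mono) auto
    then show "\<Phi> f \<le> \<bar>C\<bar>" using bound[of f] f by auto
  qed
  have zero: "\<Phi> (\<lambda>_. 0) = 0" using hom[OF closed_subspaceD(2)[OF W], of 0] by simp
  show "0 \<le> (SUP f\<in>?B. \<Phi> f)"
    using cSUP_upper[OF _ bdd, of "\<lambda>_. 0"] closed_subspaceD(2)[OF W] zero by simp
  show "\<Phi> f \<le> (SUP f\<in>?B. \<Phi> f) * l2_norm p f" if f: "f \<in> W"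
  proof (cases "f = (\<lambda>_. 0)")
    case True
    then show ?thesis using zero by simp
  next
    case False
    define c where "c = l2_norm p f"
    have c: "c > 0" unfolding c_def using norm_pos closed_subspaceD(1)[OF W f] False by blast
    let ?g = "\<lambda>x. of_real (1 / c) * f x"
    have "\<Phi> ?g \<le> (SUP f\<in>?B. \<Phi> f)"
    proof (rule cSUP_upper[OF _ bdd])
      show "?g \<in> ?B"
        using closed_subspaceD(4)[OF W f, of "of_real (1 / c)"] c norm_scale[of "of_real (1 / c)" f]
        by (simp only: mem_Collect_eq norm_of_real c_def[symmetric]) simp
    qed
    then have "\<Phi> f / c \<le> (SUP f\<in>?B. \<Phi> f)" unfolding hom[OF f] using c by (simp add: norm_divide)
    then show ?thesis using c by (simp add: c_def pos_divide_le_eq)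
  qed
qed

lemma
  assumes W: "closed_subspace W" and T: "bounded_on W T"
  shows norm_on_bdd: "bdd_above ((\<lambda>f. l2_norm p (T f)) ` {f \<in> W. l2_norm p f \<le> 1})"
    and norm_on_le: "f \<in> W \<Longrightarrow> l2_norm p (T f) \<le> norm_on W T * l2_norm p f"
    and norm_on_nonneg: "norm_on W T \<ge> 0"
proof -
  obtain C where C: "\<And>f. f \<in> W \<Longrightarrow> l2_norm p (T f) \<le> C * l2_norm p f"
    using bounded_on_obtain[OF T] by blast
  have hom: "l2_norm p (T (\<lambda>x. a * f x)) = cmod a * l2_norm p (T f)" if "f \<in> W" for f a
    unfolding bounded_onD(3)[OF T that] by (rule norm_scale)
  note sup = unit_ball_supremum[OF W, of "\<lambda>f. l2_norm p (T f)", OF hom C]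
  show "bdd_above ((\<lambda>f. l2_norm p (T f)) ` {f \<in> W. l2_norm p f \<le> 1})" by (rule sup(1))
  show "f \<in> W \<Longrightarrow> l2_norm p (T f) \<le> norm_on W T * l2_norm p f" unfolding norm_on_def by (rule sup(2))
  show "norm_on W T \<ge> 0" unfolding norm_on_def by (rule sup(3))
qed

lemma bounded_on_continuous:
  assumes "bounded_on W T" "closed_subspace W" "\<And>n. u n \<in> W" "g \<in> W"
    and lim: "(\<lambda>n. l2_norm p (\<lambda>x. u n x - g x)) \<longlonglongrightarrow> 0"
  shows "(\<lambda>n. l2_norm p (\<lambda>x. T (u n) x - T g x)) \<longlonglongrightarrow> 0"
proof (rule tendsto_sandwich[OF _ _ tendsto_const])
  have "l2_norm p (\<lambda>x. T (u n) x - T g x) \<le> norm_on W T * l2_norm p (\<lambda>x. u n x - g x)" for n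
    using norm_on_le[OF assms(2,1) closed_subspaceD(5)[OF assms(2), of "u n" g]]
    by (simp add: assms bounded_onD(4)[OF assms(1)])
  then show "\<forall>\<^sub>F n in sequentially. l2_norm p (\<lambda>x. T (u n) x - T g x)
      \<le> norm_on W T * l2_norm p (\<lambda>x. u n x - g x)" by simp
  show "(\<lambda>n. norm_on W T * l2_norm p (\<lambda>x. u n x - g x)) \<longlonglongrightarrow> 0"
    using tendsto_mult_right_zero[OF lim] by simp
qed simp

lemma norm_tendsto:
  assumes "\<And>n. u n \<in> l2 p" "g \<in> l2 p" and lim: "(\<lambda>n. l2_norm p (\<lambda>x. u n x - g x)) \<longlonglongrightarrow> 0"
  shows "(\<lambda>n. l2_norm p (u n)) \<longlonglongrightarrow> l2_norm p g"
proof (rule Lim_transform2[OF tendsto_const], rule tendsto_rabs_zero_cancel,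
    rule tendsto_sandwich[OF _ _ tendsto_const lim])
  have "\<bar>l2_norm p g - l2_norm p (u n)\<bar> \<le> l2_norm p (\<lambda>x. u n x - g x)" for n
    using norm_triangle_sub[OF assms(1,2), of n] norm_triangle_sub[OF assms(2) assms(1), of n]
      norm_minus_commute[of "u n" g] by (simp add: abs_le_iff)
  then show "\<forall>\<^sub>F n in sequentially. \<bar>l2_norm p g - l2_norm p (u n)\<bar> \<le> l2_norm p (\<lambda>x. u n x - g x)"
    by simp
qed simp

lemma tendsto_sub:
  assumes "\<And>n. u n \<in> l2 p" "\<And>n. v n \<in> l2 p" "g \<in> l2 p"
    and "(\<lambda>n. l2_norm p (\<lambda>x. u n x - g x)) \<longlonglongrightarrow> 0" "(\<lambda>n. l2_norm p (\<lambda>x. u n x - v n x)) \<longlonglongrightarrow> 0"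
  shows "(\<lambda>n. l2_norm p (\<lambda>x. v n x - g x)) \<longlonglongrightarrow> 0"
proof (rule tendsto_sandwich[OF _ _ tendsto_const])
  have "l2_norm p (\<lambda>x. v n x - g x) \<le> l2_norm p (\<lambda>x. u n x - g x) + l2_norm p (\<lambda>x. u n x - v n x)" for n
    using norm_diff_le[OF diff_mem[OF assms(1)[of n] assms(3)] diff_mem[OF assms(1)[of n] assms(2)[of n]]]
    by simp
  then show "\<forall>\<^sub>F n in sequentially. l2_norm p (\<lambda>x. v n x - g x) \<le>
      l2_norm p (\<lambda>x. u n x - g x) + l2_norm p (\<lambda>x. u n x - v n x)" by simp
  show "(\<lambda>n. l2_norm p (\<lambda>x. u n x - g x) + l2_norm p (\<lambda>x. u n x - v n x)) \<longlonglongrightarrow> 0"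
    using tendsto_add[OF assms(4,5)] by simp
qed simp

lemma orthogonal_closed_subspace:
  assumes e: "e \<in> l2 p"
  shows "closed_subspace {f \<in> l2 p. l2_inner p f e = 0}" (is "closed_subspace ?W")
  unfolding closed_subspace_def
proof (intro conjI allI impI ballI subsetI)
  fix f g a b assume "f \<in> ?W" "g \<in> ?W"
  then show "(\<lambda>x. a * f x + b * g x) \<in> ?W"
    using lincomb_mem inner_lincomb_left e by simp
next
  fix f g assume f: "\<forall>n. f n \<in> ?W" and g: "g \<in> l2 p"
    and lim: "(\<lambda>n. l2_norm p (\<lambda>x. f n x - g x)) \<longlonglongrightarrow> 0"
  have "cmod (l2_inner p g e) \<le> l2_norm p (\<lambda>x. f n x - g x) * l2_norm p e" for n
    using Cauchy_Schwarz[OF diff_mem[of "f n" g] e] inner_diff_left[of "f n" g e] f g e by simp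
  moreover have "(\<lambda>n. l2_norm p (\<lambda>x. f n x - g x) * l2_norm p e) \<longlonglongrightarrow> 0"
    using tendsto_mult_left_zero[OF lim] .
  ultimately have "cmod (l2_inner p g e) \<le> 0" by (intro LIMSEQ_le_const) auto
  then show "g \<in> ?W" using g by simp
qed (simp_all add: zero_mem)

lemma bounded_op_iff: "bounded_op p p T \<longleftrightarrow> bounded_on (l2 p) T"
  by (simp add: bounded_op_def bounded_on_def)

lemma l2_closed_subspace: "closed_subspace (l2 p)"
  unfolding closed_subspace_def using zero_mem lincomb_mem by blast

lemma norm_on_iterate:
  assumes V: "closed_subspace V" and T: "bounded_on V T" and f: "f \<in> V"
  shows "(T ^^ n) f \<in> V \<and> l2_norm p ((T ^^ n) f) \<le> norm_on V T ^ n * l2_norm p f"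
proof (induction n)
  case 0
  then show ?case using f by simp
next
  case (Suc n)
  then have IH: "(T ^^ n) f \<in> V" "l2_norm p ((T ^^ n) f) \<le> norm_on V T ^ n * l2_norm p f" by auto
  have "l2_norm p ((T ^^ Suc n) f) \<le> norm_on V T * l2_norm p ((T ^^ n) f)"
    using norm_on_le[OF V T IH(1)] by simp
  also have "\<dots> \<le> norm_on V T * (norm_on V T ^ n * l2_norm p f)"
    by (intro mult_left_mono IH norm_on_nonneg[OF V T])
  finally show ?case using bounded_onD(1)[OF T IH(1)] by (simp add: mult_ac)
qed

section \<open>Compact normal operators\<close>

text \<open>
  Here \<open>B\<close> is the adjoint of \<open>A\<close>, and \<open>s\<close> is the norm of \<open>A\<close>. For a unit vector \<open>f\<close>, normality gives
  \<open>\<parallel>B A f\<parallel> = \<parallel>A A f\<parallel> \<le> s^2\<close>, hence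
  \<open>\<parallel>B A f - s^2 f\<parallel>^2 = \<parallel>B A f\<parallel>^2 + s^4 \<parallel>f\<parallel>^2 - 2 s^2 \<parallel>A f\<parallel>^2 \<le> 2 s^2 (s^2 - \<parallel>A f\<parallel>^2)\<close>.
  Along a maximizing sequence the right-hand side tends to zero, so the sequence approaches \<open>B A f / s^2\<close>,
  which has a convergent subsequence by compactness. The limit is the eigenvector.
\<close>

lemma maximizing_eigenvector:
  assumes W: "closed_subspace W" and nz: "f0 \<in> W" "f0 \<noteq> (\<lambda>_. 0)"
    and A: "bounded_on W A" and B: "bounded_on W B"
    and adj: "\<And>f g. f \<in> W \<Longrightarrow> g \<in> W \<Longrightarrow> l2_inner p (A f) g = l2_inner p f (B g)"
    and comm: "\<And>f. f \<in> W \<Longrightarrow> A (B f) = B (A f)"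
    and compact: "compact_on W A"
  defines "s \<equiv> norm_on W A"
  shows "\<exists>f\<in>W. f \<noteq> (\<lambda>_. 0) \<and> B (A f) = (\<lambda>x. of_real (s\<^sup>2) * f x)"
proof (cases "s = 0")
  case True
  have "l2_norm p (A f0) \<le> 0" using norm_on_le[OF W A nz(1)] True by (simp add: s_def)
  then have "A f0 = (\<lambda>_. 0)"
    using norm_eq_0_imp closed_subspaceD(1)[OF W bounded_onD(1)[OF A nz(1)]] antisym norm_nonneg
    by blast
  moreover have "B (\<lambda>_. 0) = (\<lambda>_. 0)"
    using bounded_onD(3)[OF B nz(1), of 0] by simp
  ultimately show ?thesis using nz True by (intro bexI[of _ f0]) auto
next
  case False
  note l2 = closed_subspaceD(1)[OF W]
  note AW = bounded_onD(1)[OF A] and BW = bounded_onD(1)[OF B]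
  have s: "s > 0" using False norm_on_nonneg[OF W A] by (simp add: s_def)
  have Abound: "l2_norm p (A f) \<le> s * l2_norm p f" if "f \<in> W" for f
    using norm_on_le[OF W A that] by (simp add: s_def)
  have defect: "(l2_norm p (\<lambda>x. B (A f) x - of_real (s\<^sup>2) * f x))\<^sup>2 \<le> 2 * s\<^sup>2 * (s\<^sup>2 - (l2_norm p (A f))\<^sup>2)"
    if f: "f \<in> W" "l2_norm p f \<le> 1" for f
  proof -
    have "l2_inner p f (B (A f)) = of_real ((l2_norm p (A f))\<^sup>2)"
      using adj[OF f(1) AW[OF f(1)]] inner_self[OF l2[OF AW[OF f(1)]]] by simp
    then have inn: "l2_inner p (B (A f)) f = of_real ((l2_norm p (A f))\<^sup>2)"
      by (subst inner_commute) simp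
    have "of_real ((l2_norm p (B (A f)))\<^sup>2) = l2_inner p (A (B (A f))) (A f)"
      using inner_self[OF l2[OF BW[OF AW[OF f(1)]]]] adj[OF BW[OF AW[OF f(1)]] AW[OF f(1)]] by simp
    also have "\<dots> = cnj (l2_inner p (A (A f)) (A (A f)))"
      using adj[OF AW[OF f(1)] AW[OF AW[OF f(1)]]] comm[OF AW[OF f(1)]]
        inner_commute[of "B (A (A f))" "A f"] by simp
    also have "\<dots> = of_real ((l2_norm p (A (A f)))\<^sup>2)"
      using inner_self[OF l2[OF AW[OF AW[OF f(1)]]]] by simp
    finally have eq: "(l2_norm p (B (A f)))\<^sup>2 = (l2_norm p (A (A f)))\<^sup>2"
      using of_real_eq_iff by blast
    have "l2_norm p (A (A f)) \<le> s * (s * l2_norm p f)"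
      using Abound[OF AW[OF f(1)]] Abound[OF f(1)] s by (meson less_imp_le mult_left_mono order_trans)
    also have "\<dots> \<le> s * (s * 1)" using f(2) s by (intro mult_left_mono) auto
    finally have "(l2_norm p (A (A f)))\<^sup>2 \<le> (s\<^sup>2)\<^sup>2"
      by (intro power_mono) (auto simp: power2_eq_square)
    then have BA: "(l2_norm p (B (A f)))\<^sup>2 \<le> s ^ 4" using eq by simp
    have "(l2_norm p f)\<^sup>2 \<le> 1" using f(2) by (simp add: power_le_one)
    then have "s ^ 4 * (l2_norm p f)\<^sup>2 \<le> s ^ 4" using s by (intro mult_left_le) auto
    then show ?thesis
      using norm_lincomb_power2[OF l2[OF BW[OF AW[OF f(1)]]] l2[OF f(1)], of 1 "- of_real (s\<^sup>2)"] BA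
      by (simp add: inn algebra_simps power_mult_distrib norm_power flip: of_real_power of_real_mult)
  qed
  have "\<exists>f\<in>W. l2_norm p f \<le> 1 \<and> s - 1 / Suc n < l2_norm p (A f)" for n
  proof -
    have "s - 1 / Suc n < (SUP f\<in>{f \<in> W. l2_norm p f \<le> 1}. l2_norm p (A f))"
      unfolding norm_on_def[symmetric] s_def[symmetric] by simp
    moreover have "{f \<in> W. l2_norm p f \<le> 1} \<noteq> {}"
      using closed_subspaceD(2)[OF W] norm_zero by fastforce
    ultimately show ?thesis
      by (subst (asm) less_cSUP_iff) (auto intro: norm_on_bdd[OF W A])
  qed
  then obtain f where f: "\<And>n. f n \<in> W" "\<And>n. l2_norm p (f n) \<le> 1"
    "\<And>n. s - 1 / Suc n < l2_norm p (A (f n))" by metis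
  have lim_s: "(\<lambda>n. l2_norm p (A (f n))) \<longlonglongrightarrow> s"
  proof (rule tendsto_sandwich[of "\<lambda>n. s - 1 / Suc n" _ _ "\<lambda>_. s"])
    have "l2_norm p (A (f n)) \<le> s" for n
      using Abound[OF f(1)[of n]] mult_left_mono[OF f(2)[of n] less_imp_le[OF s]] by simp
    then show "\<forall>\<^sub>F n in sequentially. l2_norm p (A (f n)) \<le> s" by simp
    show "(\<lambda>n. s - 1 / real (Suc n)) \<longlonglongrightarrow> s"
      using tendsto_diff[OF tendsto_const LIMSEQ_inverse_real_of_nat, of s]
      by (simp add: inverse_eq_divide)
    show "\<forall>\<^sub>F n in sequentially. s - 1 / real (Suc n) \<le> l2_norm p (A (f n))"
      by (intro always_eventually allI less_imp_le f(3))
  qed simp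
  obtain g r where g: "g \<in> W" "strict_mono r"
      "(\<lambda>n. l2_norm p (\<lambda>x. A (f (r n)) x - g x)) \<longlonglongrightarrow> 0"
    using compact f(1,2) unfolding compact_on_def by blast
  define u where "u n = f (r n)" for n
  have u: "\<And>n. u n \<in> W" "\<And>n. l2_norm p (u n) \<le> 1" by (auto simp: u_def f)
  have lim_u: "(\<lambda>n. l2_norm p (A (u n))) \<longlonglongrightarrow> s"
    using LIMSEQ_subseq_LIMSEQ[OF lim_s g(2)] by (simp add: u_def o_def)
  have BAu: "(\<lambda>n. l2_norm p (\<lambda>x. B (A (u n)) x - B g x)) \<longlonglongrightarrow> 0"
    using bounded_on_continuous[OF B W _ g(1), of "\<lambda>n. A (u n)"] g(3) AW u(1) by (simp add: u_def)
  have "(\<lambda>n. sqrt (2 * s\<^sup>2 * (s\<^sup>2 - (l2_norm p (A (u n)))\<^sup>2))) \<longlonglongrightarrow> sqrt (2 * s\<^sup>2 * (s\<^sup>2 - s\<^sup>2))"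
    by (intro tendsto_intros lim_u)
  then have sq0: "(\<lambda>n. sqrt (2 * s\<^sup>2 * (s\<^sup>2 - (l2_norm p (A (u n)))\<^sup>2))) \<longlonglongrightarrow> 0" by simp
  have dev0: "(\<lambda>n. l2_norm p (\<lambda>x. B (A (u n)) x - of_real (s\<^sup>2) * u n x)) \<longlonglongrightarrow> 0"
  proof (rule tendsto_sandwich[OF _ _ tendsto_const sq0])
    show "\<forall>\<^sub>F n in sequentially. l2_norm p (\<lambda>x. B (A (u n)) x - of_real (s\<^sup>2) * u n x)
        \<le> sqrt (2 * s\<^sup>2 * (s\<^sup>2 - (l2_norm p (A (u n)))\<^sup>2))"
      using defect[OF u] by (intro always_eventually allI real_le_rsqrt)
  qed simp
  define h where "h = (\<lambda>x. of_real (1 / s\<^sup>2) * B g x)"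
  have h: "h \<in> W" unfolding h_def by (intro closed_subspaceD(4)[OF W] BW g(1))
  have s2u: "(\<lambda>n. l2_norm p (\<lambda>x. of_real (s\<^sup>2) * u n x - B g x)) \<longlonglongrightarrow> 0"
    by (rule tendsto_sub[OF _ _ _ BAu dev0]) (intro scale_mem l2 AW BW u g(1))+
  have "l2_norm p (\<lambda>x. u n x - h x) = (1 / s\<^sup>2) * l2_norm p (\<lambda>x. of_real (s\<^sup>2) * u n x - B g x)" for n
  proof -
    have "(\<lambda>x. u n x - h x) = (\<lambda>x. of_real (1 / s\<^sup>2) * (of_real (s\<^sup>2) * u n x - B g x))"
      unfolding h_def using s by (auto simp: field_simps)
    then show ?thesis using s by (simp only: norm_scale norm_of_real) simp
  qed
  then have uh: "(\<lambda>n. l2_norm p (\<lambda>x. u n x - h x)) \<longlonglongrightarrow> 0"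
    using tendsto_mult_right_zero[OF s2u, of "1 / s\<^sup>2"] by simp
  have Auh: "(\<lambda>n. l2_norm p (\<lambda>x. A (u n) x - A h x)) \<longlonglongrightarrow> 0"
    by (rule bounded_on_continuous[OF A W u(1) h uh])
  have BAuh: "(\<lambda>n. l2_norm p (\<lambda>x. B (A (u n)) x - B (A h) x)) \<longlonglongrightarrow> 0"
    by (rule bounded_on_continuous[OF B W AW[OF u(1)] AW[OF h] Auh])
  have "B (A h) = B g"
    by (rule limit_unique[OF _ _ _ BAuh BAu]) (intro l2 AW BW u g(1) h)+
  also have "B g = (\<lambda>x. of_real (s\<^sup>2) * h x)" unfolding h_def using s by (auto simp: field_simps)
  finally have "B (A h) = (\<lambda>x. of_real (s\<^sup>2) * h x)" .
  moreover have "h \<noteq> (\<lambda>_. 0)"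
  proof
    assume "h = (\<lambda>_. 0)"
    then have "A h = (\<lambda>_. 0)" using bounded_onD(3)[OF A h, of 0] by simp
    moreover have "(\<lambda>n. l2_norm p (A (u n))) \<longlonglongrightarrow> l2_norm p (A h)"
      by (rule norm_tendsto[OF l2[OF AW[OF u(1)]] l2[OF AW[OF h]] Auh])
    ultimately show False using LIMSEQ_unique[OF lim_u] s by fastforce
  qed
  ultimately show ?thesis using h by blast
qed

text \<open>
  Factor the quadratic: either \<open>(T - z2) h\<close> vanishes, so that \<open>h\<close> is an eigenvector for \<open>z2\<close>, or it is an
  eigenvector for \<open>z1\<close>.
\<close>

lemma quadratic_eigenvector:
  assumes W: "closed_subspace W" and T: "bounded_on W T" and h: "h \<in> W" "h \<noteq> (\<lambda>_. 0)"
    and quad: "T (T h) = (\<lambda>x. (z1 + z2) * T h x - z1 * z2 * h x)"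
  shows "\<exists>k\<in>W. \<exists>z\<in>{z1, z2}. k \<noteq> (\<lambda>_. 0) \<and> T k = (\<lambda>x. z * k x)"
proof -
  define k where "k = (\<lambda>x. T h x - z2 * h x)"
  have k: "k \<in> W" unfolding k_def
    by (intro closed_subspaceD(4,5)[OF W] bounded_onD(1)[OF T] h)
  have "T k = (\<lambda>x. T (T h) x - z2 * T h x)"
    unfolding k_def
    using bounded_onD(4)[OF T bounded_onD(1)[OF T h(1)] closed_subspaceD(4)[OF W h(1), of z2]]
    unfolding bounded_onD(3)[OF T h(1)] .
  also have "\<dots> = (\<lambda>x. z1 * k x)" unfolding quad k_def by (auto simp: algebra_simps)
  finally have "T k = (\<lambda>x. z1 * k x)" .
  moreover have "T h = (\<lambda>x. z2 * h x)" if "k = (\<lambda>_. 0)"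
    using that unfolding k_def by (auto simp: fun_eq_iff)
  ultimately show ?thesis using h k by blast
qed

text \<open>
  On the eigenspace \<open>E\<close> of \<open>B A\<close> for \<open>s^2\<close> the operator \<open>A\<close> is \<open>s\<close> times an isometry, so every eigenvalue of
  \<open>A\<close> on \<open>E\<close> has modulus \<open>s\<close>; what has to be found is an eigenvector of \<open>A\<close> in \<open>E\<close>. The self-adjoint
  part \<open>X = (A + B) / 2\<close> is compact on \<open>E\<close>, so the maximum principle applied to \<open>X\<close> itself gives
  \<open>X^2 f = t^2 f\<close>, and from it an eigenvector \<open>h\<close> of \<open>X\<close> with eigenvalue \<open>\<tau>\<close>. On \<open>h\<close> one has \<open>B = 2 \<tau> - A\<close>, and \<open>A B = s^2\<close>
  becomes the quadratic relation \<open>A^2 h = 2 \<tau> A h - s^2 h\<close>, which yields the eigenvector of \<open>A\<close>. In this way no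
  dimension theory for \<open>E\<close> is involved.
\<close>

theorem normal_eigenvector:
  assumes W: "closed_subspace W" and nz: "f0 \<in> W" "f0 \<noteq> (\<lambda>_. 0)"
    and A: "bounded_on W A" and B: "bounded_on W B"
    and adj: "\<And>f g. f \<in> W \<Longrightarrow> g \<in> W \<Longrightarrow> l2_inner p (A f) g = l2_inner p f (B g)"
    and comm: "\<And>f. f \<in> W \<Longrightarrow> A (B f) = B (A f)"
    and compact: "compact_on W A"
  shows "\<exists>z. \<exists>k\<in>W. k \<noteq> (\<lambda>_. 0) \<and> A k = (\<lambda>x. z * k x) \<and> cmod z = norm_on W A"
proof (cases "norm_on W A = 0")
  case True
  have "l2_norm p (A f0) \<le> 0" using norm_on_le[OF W A nz(1)] True by simp
  then have "A f0 = (\<lambda>x. 0 * f0 x)"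
    using norm_eq_0_imp[OF closed_subspaceD(1)[OF W bounded_onD(1)[OF A nz(1)]]]
      norm_nonneg[of "A f0"] by simp
  then show ?thesis using nz True by (intro exI[of _ 0] bexI[of _ f0]) auto
next
  case False
  note l2 = closed_subspaceD(1)[OF W]
  note AW = bounded_onD(1)[OF A] and BW = bounded_onD(1)[OF B]
  define s where "s = norm_on W A"
  have s: "s > 0" using False norm_on_nonneg[OF W A] by (simp add: s_def)
  define E where "E = {f \<in> W. B (A f) = (\<lambda>x. of_real (s\<^sup>2) * f x)}"
  have E: "f \<in> W" "B (A f) = (\<lambda>x. of_real (s\<^sup>2) * f x)" if "f \<in> E" for f
    using that by (auto simp: E_def)
  have EI: "f \<in> E" if "f \<in> W" "B (A f) = (\<lambda>x. of_real (s\<^sup>2) * f x)" for f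
    using that by (auto simp: E_def)
  have AE: "A f \<in> E" if f: "f \<in> E" for f
  proof (rule EI[OF AW[OF E(1)[OF f]]])
    show "B (A (A f)) = (\<lambda>x. of_real (s\<^sup>2) * A f x)"
      using comm[OF AW[OF E(1)[OF f]]] E(2)[OF f] bounded_onD(3)[OF A E(1)[OF f]] by simp
  qed
  have BE: "B f \<in> E" if f: "f \<in> E" for f
  proof (rule EI[OF BW[OF E(1)[OF f]]])
    show "B (A (B f)) = (\<lambda>x. of_real (s\<^sup>2) * B f x)"
      using comm[OF E(1)[OF f]] E(2)[OF f] bounded_onD(3)[OF B E(1)[OF f]] by simp
  qed
  have Esub: "closed_subspace E"
    unfolding closed_subspace_def
  proof (intro conjI allI impI ballI subsetI)
    fix f assume "f \<in> E" then show "f \<in> l2 p" using E(1) l2 by blast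
  next
    show "(\<lambda>_. 0) \<in> E"
      using bounded_onD(3)[OF A nz(1), of 0] bounded_onD(3)[OF B nz(1), of 0]
        closed_subspaceD(2)[OF W] by (intro EI) simp_all
  next
    fix f g a b assume f: "f \<in> E" and g: "g \<in> E"
    have "B (A (\<lambda>x. a * f x + b * g x)) = (\<lambda>x. a * B (A f) x + b * B (A g) x)"
      unfolding bounded_onD(2)[OF A E(1)[OF f] E(1)[OF g]]
        bounded_onD(2)[OF B AW[OF E(1)[OF f]] AW[OF E(1)[OF g]]] ..
    then show "(\<lambda>x. a * f x + b * g x) \<in> E"
      unfolding E(2)[OF f] E(2)[OF g]
      by (intro EI closed_subspaceD(3)[OF W E(1)[OF f] E(1)[OF g]]) (auto simp: algebra_simps)
  next
    fix f g assume f: "\<forall>n. f n \<in> E" and g: "g \<in> l2 p"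
      and lim: "(\<lambda>n. l2_norm p (\<lambda>x. f n x - g x)) \<longlonglongrightarrow> 0"
    have fW: "f n \<in> W" for n using f E(1) by blast
    have gW: "g \<in> W" by (rule closed_subspaceD(7)[OF W fW g lim])
    have 1: "(\<lambda>n. l2_norm p (\<lambda>x. B (A (f n)) x - B (A g) x)) \<longlonglongrightarrow> 0"
      by (rule bounded_on_continuous[OF B W AW[OF fW] AW[OF gW]
            bounded_on_continuous[OF A W fW gW lim]])
    have "l2_norm p (\<lambda>x. B (A (f n)) x - of_real (s\<^sup>2) * g x) = s\<^sup>2 * l2_norm p (\<lambda>x. f n x - g x)" for n
      unfolding E(2)[OF spec[OF f]] right_diff_distrib[symmetric] norm_scale norm_of_real by simp
    then have 2: "(\<lambda>n. l2_norm p (\<lambda>x. B (A (f n)) x - of_real (s\<^sup>2) * g x)) \<longlonglongrightarrow> 0"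
      using tendsto_mult_right_zero[OF lim, of "s\<^sup>2"] by simp
    have "B (A g) = (\<lambda>x. of_real (s\<^sup>2) * g x)"
      by (rule limit_unique[OF _ _ _ 1 2]) (intro l2 AW BW fW gW scale_mem)+
    then show "g \<in> E" using EI gW by blast
  qed
  have restrict: "bounded_on E T" if T: "bounded_on W T" and "\<And>f. f \<in> E \<Longrightarrow> T f \<in> E" for T
    unfolding bounded_on_def
  proof (intro conjI ballI allI)
    show "\<exists>C. \<forall>f\<in>E. l2_norm p (T f) \<le> C * l2_norm p f"
      using norm_on_le[OF W T] E(1) by blast
  qed (use that bounded_onD(2)[OF T] E(1) in auto)
  have A_E: "bounded_on E A" by (rule restrict[OF A]) (rule AE)
  have B_E: "bounded_on E B" by (rule restrict[OF B]) (rule BE)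
  \<comment> \<open>The unit ball of E is compact: A is compact and B A = s^2 there.\<close>
  have compact_E: "\<exists>g\<in>E. \<exists>r. strict_mono r \<and> (\<lambda>n. l2_norm p (\<lambda>x. f (r n) x - g x)) \<longlonglongrightarrow> 0"
    if f: "\<And>n::nat. f n \<in> E" "\<And>n. l2_norm p (f n) \<le> 1" for f
  proof -
    obtain g r where g: "g \<in> W" "strict_mono r"
      "(\<lambda>n. l2_norm p (\<lambda>x. A (f (r n)) x - g x)) \<longlonglongrightarrow> 0"
      using compact f E(1) unfolding compact_on_def by blast
    define h where "h = (\<lambda>x. of_real (1 / s\<^sup>2) * B g x)"
    have hW: "h \<in> W" unfolding h_def by (intro closed_subspaceD(4)[OF W] BW g(1))
    have 1: "(\<lambda>n. l2_norm p (\<lambda>x. B (A (f (r n))) x - B g x)) \<longlonglongrightarrow> 0"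
      by (rule bounded_on_continuous[OF B W AW[OF E(1)[OF f(1)]] g(1) g(3)])
    have "l2_norm p (\<lambda>x. f (r n) x - h x) = 1 / s\<^sup>2 * l2_norm p (\<lambda>x. B (A (f (r n))) x - B g x)" for n
    proof -
      have "(\<lambda>x. f (r n) x - h x) = (\<lambda>x. of_real (1 / s\<^sup>2) * (B (A (f (r n))) x - B g x))"
        unfolding E(2)[OF f(1)] h_def using s by (auto simp: field_simps)
      then show ?thesis using s by (simp only: norm_scale norm_of_real) simp
    qed
    then have lim: "(\<lambda>n. l2_norm p (\<lambda>x. f (r n) x - h x)) \<longlonglongrightarrow> 0"
      using tendsto_mult_right_zero[OF 1, of "1 / s\<^sup>2"] by simp
    then have "h \<in> E" using closed_subspaceD(7)[OF Esub f(1) l2[OF hW]] by blast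
    then show ?thesis using lim g(2) by blast
  qed
  define X where "X = (\<lambda>f x. (1/2) * A f x + (1/2) * B f x)"
  have XE: "X f \<in> E" if "f \<in> E" for f
    unfolding X_def by (rule closed_subspaceD(3)[OF Esub AE[OF that] BE[OF that]])
  have X: "bounded_on E X" unfolding bounded_on_def
  proof (intro conjI ballI allI)
    fix f g a b assume f: "f \<in> E" and g: "g \<in> E"
    show "X (\<lambda>x. a * f x + b * g x) = (\<lambda>x. a * X f x + b * X g x)"
      unfolding X_def bounded_onD(2)[OF A_E f g] bounded_onD(2)[OF B_E f g]
      by (auto simp: algebra_simps)
  next
    have "l2_norm p (X f) \<le> (norm_on E A + norm_on E B) * l2_norm p f" if f: "f \<in> E" for f
    proof -
      have "l2_norm p (X f) \<le> l2_norm p (\<lambda>x. (1/2) * A f x) + l2_norm p (\<lambda>x. (1/2) * B f x)"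
        unfolding X_def
        by (intro norm_add_le scale_mem closed_subspaceD(1)[OF Esub] AE BE f)
      also have "\<dots> \<le> l2_norm p (A f) + l2_norm p (B f)" unfolding norm_scale
        by (intro add_mono mult_left_le_one_le) simp_all
      also have "\<dots> \<le> norm_on E A * l2_norm p f + norm_on E B * l2_norm p f"
        by (intro add_mono norm_on_le[OF Esub] A_E B_E f)
      finally show ?thesis by (simp add: algebra_simps)
    qed
    then show "\<exists>C. \<forall>f\<in>E. l2_norm p (X f) \<le> C * l2_norm p f" by blast
  qed (rule XE)
  have Xadj: "l2_inner p (X f) g = l2_inner p f (X g)" if f: "f \<in> E" and g: "g \<in> E" for f g
  proof -
    have "l2_inner p (B f) g = l2_inner p f (A g)"
      using adj[OF E(1)[OF g] E(1)[OF f]] inner_commute by metis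
    then show ?thesis unfolding X_def
      using adj[OF E(1)[OF f] E(1)[OF g]]
      by (subst inner_lincomb_left inner_lincomb_right; (intro closed_subspaceD(1)[OF Esub] AE BE f g)?)+
        simp
  qed
  have Xcomp: "compact_on E X" unfolding compact_on_def
  proof (intro allI impI)
    fix f assume f: "\<forall>n::nat. f n \<in> E \<and> l2_norm p (f n) \<le> 1"
    then obtain g r where g: "g \<in> E" "strict_mono r" "(\<lambda>n. l2_norm p (\<lambda>x. f (r n) x - g x)) \<longlonglongrightarrow> 0"
      using compact_E by blast
    have "(\<lambda>n. l2_norm p (\<lambda>x. X (f (r n)) x - X g x)) \<longlonglongrightarrow> 0"
      by (rule bounded_on_continuous[OF X Esub _ g(1,3)]) (use f in blast)
    then show "\<exists>g\<in>E. \<exists>r. strict_mono r \<and> (\<lambda>n. l2_norm p (\<lambda>x. X (f (r n)) x - g x)) \<longlonglongrightarrow> 0"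
      using XE[OF g(1)] g(2) by blast
  qed
  obtain e0 where e0: "e0 \<in> E" "e0 \<noteq> (\<lambda>_. 0)"
    using maximizing_eigenvector[OF W nz A B adj comm compact] EI by (auto simp: s_def[symmetric])
  define t where "t = norm_on E X"
  obtain f1 where f1: "f1 \<in> E" "f1 \<noteq> (\<lambda>_. 0)" "X (X f1) = (\<lambda>x. of_real (t\<^sup>2) * f1 x)"
    using maximizing_eigenvector[OF Esub e0 X X Xadj refl Xcomp] by (auto simp: t_def)
  have "X (X f1) = (\<lambda>x. (of_real t + - of_real t) * X f1 x - of_real t * - of_real t * f1 x)"
    unfolding f1(3) by (auto simp: power2_eq_square)
  then obtain h \<tau> where h: "h \<in> E" "h \<noteq> (\<lambda>_. 0)" "X h = (\<lambda>x. \<tau> * h x)"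
    using quadratic_eigenvector[OF Esub X f1(1,2)] by blast
  have Bh: "B h = (\<lambda>x. 2 * \<tau> * h x - A h x)"
  proof
    fix x
    have "1/2 * A h x + 1/2 * B h x = \<tau> * h x" using fun_cong[OF h(3), of x] by (simp add: X_def)
    then have "2 * (1/2 * A h x + 1/2 * B h x) = 2 * (\<tau> * h x)" by simp
    then show "B h x = 2 * \<tau> * h x - A h x" by (simp add: algebra_simps)
  qed
  have "(\<lambda>x. of_real (s\<^sup>2) * h x) = A (B h)" using comm[OF E(1)[OF h(1)]] E(2)[OF h(1)] by simp
  also have "\<dots> = (\<lambda>x. 2 * \<tau> * A h x - A (A h) x)"
    unfolding Bh bounded_onD(4)[OF A_E closed_subspaceD(4)[OF Esub h(1)] AE[OF h(1)]]
      bounded_onD(3)[OF A_E h(1)] ..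
  finally have AAh: "A (A h) x = 2 * \<tau> * A h x - of_real (s\<^sup>2) * h x" for x
    by (auto simp: fun_eq_iff algebra_simps)
  \<comment> \<open>The roots \<open>\<tau> + d\<close> and \<open>\<tau> - d\<close> of the quadratic have sum \<open>2 \<tau>\<close> and product \<open>s^2\<close>.\<close>
  define d where "d = csqrt (\<tau>\<^sup>2 - of_real (s\<^sup>2))"
  have d: "(\<tau> + d) * (\<tau> - d) = of_real (s\<^sup>2)"
    using power2_csqrt[of "\<tau>\<^sup>2 - of_real (s\<^sup>2)"] by (simp add: d_def algebra_simps power2_eq_square)
  have "A (A h) = (\<lambda>x. ((\<tau> + d) + (\<tau> - d)) * A h x - (\<tau> + d) * (\<tau> - d) * h x)"
    unfolding d using AAh by (auto simp: algebra_simps)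
  then obtain k z where k: "k \<in> E" "k \<noteq> (\<lambda>_. 0)" "A k = (\<lambda>x. z * k x)"
    using quadratic_eigenvector[OF Esub A_E h(1,2)] by blast
  have "of_real ((l2_norm p (A k))\<^sup>2) = l2_inner p k (B (A k))"
    using adj[OF E(1)[OF k(1)] AW[OF E(1)[OF k(1)]]] inner_self[OF l2[OF AW[OF E(1)[OF k(1)]]]] by simp
  also have "\<dots> = of_real (s\<^sup>2 * (l2_norm p k)\<^sup>2)"
    unfolding E(2)[OF k(1)] inner_scale_right inner_self[OF l2[OF E(1)[OF k(1)]]] by simp
  finally have "(l2_norm p (A k))\<^sup>2 = (s * l2_norm p k)\<^sup>2"
    unfolding of_real_eq_iff by (simp add: power_mult_distrib)
  then have "cmod z * l2_norm p k = s * l2_norm p k"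
    unfolding k(3) norm_scale using s by (subst (asm) power2_eq_iff_nonneg) auto
  then have "cmod z = s" using norm_pos[OF l2[OF E(1)[OF k(1)]] k(2)] by simp
  then show ?thesis using k E(1) by (auto simp: s_def)
qed

section \<open>Spectral radius from growth of powers\<close>

lemma norm_diff_telescope:
  assumes f: "\<And>n. f n \<in> l2 p" and q: "0 \<le> q" "q < 1"
    and step: "\<And>n. l2_norm p (\<lambda>x. f (Suc n) x - f n x) \<le> K * q ^ n"
  shows "l2_norm p (\<lambda>x. f (n + k) x - f n x) \<le> K * q ^ n * (1 - q ^ k) / (1 - q)"
proof (induction k)
  case (Suc k)
  have "l2_norm p (\<lambda>x. f (n + Suc k) x - f n x)
      \<le> l2_norm p (\<lambda>x. f (Suc (n + k)) x - f (n + k) x) + l2_norm p (\<lambda>x. f (n + k) x - f n x)"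
    using norm_add_le[OF diff_mem[OF f[of "Suc (n + k)"] f[of "n + k"]] diff_mem[OF f[of "n + k"] f[of n]]]
    by simp
  also have "\<dots> \<le> K * q ^ (n + k) + K * q ^ n * (1 - q ^ k) / (1 - q)"
    using step Suc by (intro add_mono)
  also have "\<dots> = K * q ^ n * (1 - q ^ Suc k) / (1 - q)"
    using q by (simp add: field_simps power_add)
  finally show ?case .
qed simp

lemma geometric_convergence:
  assumes f: "\<And>n. f n \<in> l2 p" and q: "0 \<le> q" "q < 1" and K: "0 \<le> K"
    and step: "\<And>n. l2_norm p (\<lambda>x. f (Suc n) x - f n x) \<le> K * q ^ n"
  shows "\<exists>g\<in>l2 p. (\<lambda>n. l2_norm p (\<lambda>x. f n x - g x)) \<longlonglongrightarrow> 0"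
proof (rule complete[OF f])
  fix e :: real assume e: "e > 0"
  have tail: "l2_norm p (\<lambda>x. f (n + k) x - f n x) \<le> K * q ^ n / (1 - q)" for n k
  proof -
    have "K * q ^ n * (1 - q ^ k) \<le> K * q ^ n * 1" using q K by (intro mult_left_mono) auto
    then have "K * q ^ n * (1 - q ^ k) / (1 - q) \<le> K * q ^ n / (1 - q)"
      using q by (intro divide_right_mono) auto
    then show ?thesis using norm_diff_telescope[OF f q step, of n k] by linarith
  qed
  have "(\<lambda>n. K * q ^ n / (1 - q)) \<longlonglongrightarrow> K * 0 / (1 - q)"
    using q by (intro tendsto_intros LIMSEQ_power_zero) auto
  then have "\<forall>\<^sub>F n in sequentially. K * q ^ n / (1 - q) < e / 2"
    using e by (intro order_tendstoD(2)) auto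
  then obtain M where M: "\<And>n. n \<ge> M \<Longrightarrow> K * q ^ n / (1 - q) < e / 2"
    by (auto simp: eventually_sequentially)
  have "l2_norm p (\<lambda>x. f m x - f n x) \<le> e" if "m \<ge> M" "n \<ge> M" for m n
  proof -
    have "l2_norm p (\<lambda>x. f m x - f M x) \<le> e / 2" "l2_norm p (\<lambda>x. f n x - f M x) \<le> e / 2"
      using order_trans[OF tail[of M "m - M"] less_imp_le[OF M[of M]]]
        order_trans[OF tail[of M "n - M"] less_imp_le[OF M[of M]]] that by simp_all
    then show ?thesis
      using norm_diff_le[OF diff_mem[OF f[of m] f[of M]] diff_mem[OF f[of n] f[of M]]] by simp
  qed
  then show "\<exists>M. \<forall>m\<ge>M. \<forall>n\<ge>M. l2_norm p (\<lambda>x. f m x - f n x) \<le> e" by blast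
qed

text \<open>
  The Neumann series of the resolvent converges geometrically with ratio \<open>r / \<bar>z\<bar>\<close>. Allowing a constant \<open>C\<close>
  in front of \<open>r^n\<close> makes the criterion invariant under similarity.
\<close>

lemma not_in_spectrum:
  assumes V: "closed_subspace V" and T: "bounded_on V T" and r: "0 \<le> r" and C: "0 \<le> C"
    and growth: "\<And>f n. f \<in> V \<Longrightarrow> l2_norm p ((T ^^ n) f) \<le> C * r ^ n * l2_norm p f"
    and z: "cmod z > r"
  shows "z \<notin> spectrum_on p V T"
proof -
  note l2 = closed_subspaceD(1)[OF V] and TV = bounded_onD(1)[OF T]
  let ?R = "\<lambda>f x. z * f x - T f x"
  define q where "q = r / cmod z"
  have z0: "z \<noteq> 0" "cmod z > 0" using z r by auto
  have q: "0 \<le> q" "q < 1" using z z0(2) r by (auto simp: q_def divide_less_eq)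
  define K where "K = C / (cmod z * (1 - q))"
  have TnV: "(T ^^ n) f \<in> V" if "f \<in> V" for f n using that TV by (induction n) auto
  have inj: "f = g" if fg: "f \<in> V" "g \<in> V" "?R f = ?R g" for f g
  proof -
    define d where "d = (\<lambda>x. f x - g x)"
    have dV: "d \<in> V" unfolding d_def by (rule closed_subspaceD(5)[OF V fg(1,2)])
    have Td: "T d = (\<lambda>x. z * d x)"
      unfolding d_def bounded_onD(4)[OF T fg(1,2)] using fg(3)
      by (auto simp: fun_eq_iff algebra_simps)
    have Tn: "(T ^^ n) d = (\<lambda>x. z ^ n * d x)" for n
    proof (induction n)
      case (Suc n)
      then show ?case using bounded_onD(3)[OF T dV, of "z ^ n"] Td by (simp add: mult_ac)
    qed simp
    have "l2_norm p d \<le> C * l2_norm p d * q ^ n" for n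
    proof -
      have "cmod z ^ n * l2_norm p d \<le> C * r ^ n * l2_norm p d"
        using growth[OF dV, of n] unfolding Tn norm_scale by (simp add: norm_power)
      then show ?thesis using z0 by (simp add: q_def field_simps)
    qed
    moreover have "(\<lambda>n. C * l2_norm p d * q ^ n) \<longlonglongrightarrow> C * l2_norm p d * 0"
      using q by (intro tendsto_intros LIMSEQ_power_zero) auto
    ultimately have "l2_norm p d \<le> 0" by (intro LIMSEQ_le_const) auto
    then have "d = (\<lambda>_. 0)" using norm_eq_0_imp[OF l2[OF dV]] norm_nonneg[of d] by simp
    then show "f = g" by (auto simp: d_def fun_eq_iff)
  qed
  have surj: "\<exists>h\<in>V. ?R h = g \<and> l2_norm p h \<le> K * l2_norm p g" if g: "g \<in> V" for g
  proof -
    \<comment> \<open>The partial sums of the Neumann series, obtained by iterating h = (g + T h) / z.\<close>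
    define F where "F h = (\<lambda>x. (1 / z) * g x + (1 / z) * T h x)" for h
    define u where "u n = (F ^^ n) (\<lambda>_. 0)" for n
    have FV: "F h \<in> V" if "h \<in> V" for h
      unfolding F_def by (rule closed_subspaceD(3)[OF V g TV[OF that]])
    have uV: "u n \<in> V" for n unfolding u_def
      using closed_subspaceD(2)[OF V] FV by (induction n) auto
    have T0: "T (\<lambda>_. 0) = (\<lambda>_. 0)" using bounded_onD(3)[OF T g, of 0] by simp
    have du: "(\<lambda>x. u (Suc n) x - u n x) = (\<lambda>x. (1 / z) ^ Suc n * (T ^^ n) g x)" for n
    proof (induction n)
      case 0 then show ?case by (simp add: u_def F_def T0)
    next
      case (Suc n)
      have "(\<lambda>x. u (Suc (Suc n)) x - u (Suc n) x) = (\<lambda>x. (1 / z) * (T (u (Suc n)) x - T (u n) x))"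
        by (simp add: u_def F_def algebra_simps)
      also have "(\<lambda>x. T (u (Suc n)) x - T (u n) x) = T (\<lambda>x. u (Suc n) x - u n x)"
        using bounded_onD(4)[OF T uV uV, of "Suc n" n] by simp
      then have "(\<lambda>x. (1 / z) * (T (u (Suc n)) x - T (u n) x)) =
          (\<lambda>x. (1 / z) * T (\<lambda>x. u (Suc n) x - u n x) x)" by (simp add: fun_eq_iff)
      also have "\<dots> = (\<lambda>x. (1 / z) ^ Suc (Suc n) * (T ^^ Suc n) g x)"
        unfolding Suc bounded_onD(3)[OF T TnV[OF g]] by (simp add: mult_ac)
      finally show ?case .
    qed
    define L where "L = C * l2_norm p g / cmod z"
    have L: "L \<ge> 0" using C z0 by (simp add: L_def)
    have step: "l2_norm p (\<lambda>x. u (Suc n) x - u n x) \<le> L * q ^ n" for n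
    proof -
      have "l2_norm p (\<lambda>x. u (Suc n) x - u n x) = (1 / cmod z) ^ Suc n * l2_norm p ((T ^^ n) g)"
        unfolding du norm_scale by (simp add: norm_power norm_divide)
      also have "\<dots> \<le> (1 / cmod z) ^ Suc n * (C * r ^ n * l2_norm p g)"
        using z0 by (intro mult_left_mono growth g) auto
      also have "\<dots> = L * q ^ n" by (simp add: L_def q_def field_simps power_divide)
      finally show ?thesis .
    qed
    obtain h where h: "h \<in> l2 p" "(\<lambda>n. l2_norm p (\<lambda>x. u n x - h x)) \<longlonglongrightarrow> 0"
      using geometric_convergence[OF l2[OF uV] q L step] by blast
    have hV: "h \<in> V" by (rule closed_subspaceD(7)[OF V uV h])
    have Fh: "(\<lambda>n. l2_norm p (\<lambda>x. u (Suc n) x - F h x)) \<longlonglongrightarrow> 0"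
    proof -
      have "l2_norm p (\<lambda>x. u (Suc n) x - F h x) = (1 / cmod z) * l2_norm p (\<lambda>x. T (u n) x - T h x)" for n
      proof -
        have "(\<lambda>x. u (Suc n) x - F h x) = (\<lambda>x. (1 / z) * (T (u n) x - T h x))"
          by (simp add: u_def F_def algebra_simps)
        then show ?thesis by (simp only: norm_scale) (simp add: norm_divide)
      qed
      then show ?thesis
        using tendsto_mult_right_zero[OF bounded_on_continuous[OF T V uV hV h(2)], of "1 / cmod z"] by simp
    qed
    have "F h = h"
      by (rule limit_unique[OF l2[OF uV] l2[OF FV[OF hV]] h(1) Fh LIMSEQ_Suc[OF h(2)]])
    then have "(1 / z) * g x + (1 / z) * T h x = h x" for x by (simp add: F_def fun_eq_iff)
    then have "?R h = g" using z0 by (simp add: fun_eq_iff field_simps)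
    moreover have "l2_norm p h \<le> K * l2_norm p g"
    proof (rule LIMSEQ_le_const2[OF norm_tendsto[OF l2[OF uV] h]], intro exI allI impI)
      fix n
      have "l2_norm p (u n) \<le> L * (1 - q ^ n) / (1 - q)"
        using norm_diff_telescope[OF l2[OF uV] q step, of 0 n] by (simp add: u_def)
      also have "\<dots> \<le> L * 1 / (1 - q)"
        using q L by (intro divide_right_mono mult_left_mono) auto
      finally show "l2_norm p (u n) \<le> K * l2_norm p g" by (simp add: L_def K_def mult_ac)
    qed
    ultimately show ?thesis using hV by blast
  qed
  have RV: "?R f \<in> V" if "f \<in> V" for f
    by (rule closed_subspaceD(5)[OF V closed_subspaceD(4)[OF V that] TV[OF that]])
  have injR: "inj_on ?R V" using inj by (rule inj_onI)
  have "bij_betw ?R V V"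
    unfolding bij_betw_def using injR RV surj by (auto simp: image_iff)
  moreover have "l2_norm p (inv_into V ?R g) \<le> K * l2_norm p g" if g: "g \<in> V" for g
  proof -
    obtain h where h: "h \<in> V" "?R h = g" "l2_norm p h \<le> K * l2_norm p g" using surj[OF g] by blast
    have "inv_into V ?R g = h" using inv_into_f_f[OF injR h(1)] h(2) by simp
    then show ?thesis using h(3) by simp
  qed
  ultimately show ?thesis unfolding spectrum_on_def by blast
qed

text \<open>
  Growth of the powers bounds the spectrum from outside, an eigenvector attains the bound. This avoids
  any discussion of the spectrum of a compact operator beyond a single eigenvalue.
\<close>

lemma spectral_radius_eqI:
  assumes V: "closed_subspace V" and T: "bounded_on V T" and C: "0 \<le> C"
    and growth: "\<And>f n. f \<in> V \<Longrightarrow> l2_norm p ((T ^^ n) f) \<le> C * cmod z ^ n * l2_norm p f"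
    and k: "k \<in> V" "k \<noteq> (\<lambda>_. 0)" "T k = (\<lambda>x. z * k x)"
  shows "spectral_radius_on p V T = cmod z"
proof -
  have "\<not> inj_on (\<lambda>f x. z * f x - T f x) V"
  proof
    assume inj: "inj_on (\<lambda>f x. z * f x - T f x) V"
    have "T (\<lambda>_. 0) = (\<lambda>_. 0)" using bounded_onD(3)[OF T k(1), of 0] by simp
    then show False using inj_onD[OF inj _ k(1) closed_subspaceD(2)[OF V]] k by simp
  qed
  then have zs: "z \<in> spectrum_on p V T" by (auto simp: spectrum_on_def bij_betw_def)
  have le: "cmod w \<le> cmod z" if "w \<in> spectrum_on p V T" for w
    using not_in_spectrum[OF V T norm_ge_zero C growth, of w] that by force
  show ?thesis unfolding spectral_radius_on_def
    using zs le by (intro cSup_eq_maximum) auto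
qed

end

lemma op_norm_le:
  assumes "pos_weight p" "pos_weight q" and T: "bounded_op p q T"
  shows "f \<in> l2 p \<Longrightarrow> l2_norm q (T f) \<le> op_norm p q T * l2_norm p f" and "0 \<le> op_norm p q T"
proof -
  interpret p: pos_weight p by fact
  interpret q: pos_weight q by fact
  obtain C where C: "\<And>f. f \<in> l2 p \<Longrightarrow> l2_norm q (T f) \<le> C * l2_norm p f"
    using T unfolding bounded_op_def by blast
  have hom: "l2_norm q (T (\<lambda>x. a * f x)) = cmod a * l2_norm q (T f)" if f: "f \<in> l2 p" for f a
  proof -
    have "T (\<lambda>x. a * f x + 0 * f x) = (\<lambda>x. a * T f x + 0 * T f x)"
      using T f unfolding bounded_op_def by blast
    then show ?thesis by (simp add: q.norm_scale)
  qed
  note sup = p.unit_ball_supremum[OF p.l2_closed_subspace, of "\<lambda>f. l2_norm q (T f)", OF hom C]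
  show "f \<in> l2 p \<Longrightarrow> l2_norm q (T f) \<le> op_norm p q T * l2_norm p f" unfolding op_norm_def by (rule sup(2))
  show "0 \<le> op_norm p q T" unfolding op_norm_def by (rule sup(3))
qed

section \<open>Kernels acting on functions and their adjoints\<close>

text \<open>
  A divergent sum has the default value 0 on either side.
\<close>

lemma infsum_complex_of_real: "(\<Sum>\<^sub>\<infinity>x\<in>A. complex_of_real (f x)) = of_real (\<Sum>\<^sub>\<infinity>x\<in>A. f x)"
proof (cases "f summable_on A")
  case True
  then show ?thesis by (intro infsumI has_sum_of_real has_sum_infsum)
next
  case False
  then have "\<not> (\<lambda>x. complex_of_real (f x)) summable_on A"
    using summable_on_Re[of "\<lambda>x. complex_of_real (f x)" A] by auto
  then show ?thesis using False by (simp add: infsum_not_exists)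
qed

locale bounded_kernel = pos_weight +
  fixes K :: "'a \<Rightarrow> 'a \<Rightarrow> real"
  assumes kernel: "markov_kernel K" and bounded: "bounded_op p p (kernel_op K)"
begin

lemma kernel_nonneg [simp]: "0 \<le> K x y" and row_sum: "(K x has_sum 1) UNIV"
  using kernel by (auto simp: markov_kernel_def)

lemma bounded_l2: "bounded_on (l2 p) (kernel_op K)"
  using bounded bounded_op_iff by simp

lemmas op_mem = bounded_onD(1)[OF bounded_l2]

lemma modulus_mem: "f \<in> l2 p \<Longrightarrow> (\<lambda>x. of_real (cmod (f x))) \<in> l2 p"
  by (simp add: mem_l2_iff)

text \<open>
  A divergent \<open>infsum\<close> has the default value 0, so a linear operator cannot contain one: if the sum
  for \<open>\<bar>f\<bar>\<close> diverges in row \<open>x\<close>, then so does the sum for \<open>\<bar>f\<bar> + \<delta>\<close> with \<open>\<delta>\<close> the indicator of a point \<open>y0\<close>. Additivity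
  would give \<open>0 = 0 + K x y0\<close>, but some entry of the row is not zero.
\<close>

lemma row_summable:
  assumes f: "f \<in> l2 p"
  shows "(\<lambda>y. K x y * cmod (f y)) summable_on UNIV"
proof (rule ccontr)
  assume not: "\<not> ?thesis"
  have div: "kernel_op K (\<lambda>y. complex_of_real (h y)) x = 0" if "\<not> (\<lambda>y. K x y * h y) summable_on UNIV" for h
    using infsum_not_exists[OF that] infsum_complex_of_real[of "\<lambda>y. K x y * h y" UNIV]
    by (simp add: kernel_op_def)
  obtain y0 where y0: "K x y0 \<noteq> 0"
  proof -
    have "\<exists>y. K x y \<noteq> 0"
    proof (rule ccontr)
      assume "\<nexists>y. K x y \<noteq> 0"
      then have "K x = (\<lambda>_. 0)" by auto
      then show False using row_sum[of x] has_sum_unique[OF has_sum_0[of UNIV "\<lambda>_. 0::real"]] by fastforce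
    qed
    then show thesis using that by blast
  qed
  let ?d = "\<lambda>y. if y = y0 then 1 else 0 :: real"
  have Kd: "((\<lambda>y. K x y * ?d y) has_sum K x y0) UNIV"
    by (rule has_sum_finite_neutralI[of "{y0}"]) auto
  then have d: "kernel_op K (\<lambda>y. of_real (?d y)) x = of_real (K x y0)"
    using infsum_complex_of_real[of "\<lambda>y. K x y * ?d y" UNIV] infsumI[OF Kd] by (simp add: kernel_op_def)
  have "\<not> (\<lambda>y. K x y * (cmod (f y) + ?d y)) summable_on UNIV"
  proof
    assume "(\<lambda>y. K x y * (cmod (f y) + ?d y)) summable_on UNIV"
    from summable_on_add[OF this summable_on_uminus[THEN iffD2, OF has_sum_imp_summable[OF Kd]]]
    have "(\<lambda>y. K x y * cmod (f y)) summable_on UNIV" by (simp add: algebra_simps)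
    then show False using not by blast
  qed
  from div[OF this] have "kernel_op K (\<lambda>y. of_real (cmod (f y)) + of_real (?d y)) x = 0" by simp
  moreover have "kernel_op K (\<lambda>y. of_real (cmod (f y)) + of_real (?d y))
      = (\<lambda>x. kernel_op K (\<lambda>y. of_real (cmod (f y))) x + kernel_op K (\<lambda>y. of_real (?d y)) x)"
    using indicator_mem[of y0]
    by (intro bounded_onD(5)[OF bounded_l2] modulus_mem f) (simp add: if_distrib cong: if_cong)
  ultimately show False using d div[OF not] y0 by simp
qed

lemma kernel_modulus:
  assumes "f \<in> l2 p"
  shows "((\<lambda>y. K x y * cmod (f y)) has_sum cmod (kernel_op K (\<lambda>y. of_real (cmod (f y))) x)) UNIV"
proof -
  have "kernel_op K (\<lambda>y. of_real (cmod (f y))) x = of_real (\<Sum>\<^sub>\<infinity>y. K x y * cmod (f y))"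
    using infsum_complex_of_real[of "\<lambda>y. K x y * cmod (f y)" UNIV] by (simp add: kernel_op_def)
  moreover have "(\<Sum>\<^sub>\<infinity>y. K x y * cmod (f y)) \<ge> 0" by (intro infsum_nonneg) simp
  ultimately show ?thesis using row_summable[OF assms, of x] by simp
qed

lemma pair_summable:
  assumes f: "f \<in> l2 p" and g: "g \<in> l2 p"
  shows "(\<lambda>(x, y). of_real (K x y) * f y * cnj (g x) * of_real (p x)) summable_on UNIV \<times> UNIV"
proof -
  let ?Kf = "kernel_op K (\<lambda>y. of_real (cmod (f y)))"
  have "(\<lambda>z. norm (case z of (x, y) \<Rightarrow> of_real (K x y) * f y * cnj (g x) * of_real (p x)))
      summable_on UNIV \<times> UNIV"
  proof (rule summable_on_SigmaI)
    show "((\<lambda>y. norm (case (x, y) of (x, y) \<Rightarrow> of_real (K x y) * f y * cnj (g x) * of_real (p x)))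
        has_sum norm (?Kf x * cnj (g x) * of_real (p x))) UNIV" for x
      using has_sum_cmult_left[OF kernel_modulus[OF f, of x], of "cmod (g x) * p x"] weight_pos[of x]
      by (simp add: norm_mult mult.assoc)
    show "(\<lambda>x. norm (?Kf x * cnj (g x) * of_real (p x))) summable_on UNIV"
      by (intro inner_abs_summable op_mem modulus_mem f g)
  qed simp
  then show ?thesis by (rule abs_summable_summable)
qed

abbreviation "adj_op \<equiv> kernel_op (time_reversal p K)"

text \<open>
  Fubini: the double sum converges absolutely since \<open>K \<bar>f\<bar>\<close> is again square-summable. Whether the
  image of \<open>g\<close> under the time-reversal is square-summable is not yet known here; the inner product is only
  read as a sum.
\<close>

lemma adjoint:
  assumes f: "f \<in> l2 p" and g: "g \<in> l2 p"
  shows "l2_inner p (kernel_op K f) g = l2_inner p f (adj_op g)"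
proof -
  have "l2_inner p (kernel_op K f) g
      = (\<Sum>\<^sub>\<infinity>x. \<Sum>\<^sub>\<infinity>y. of_real (K x y) * f y * cnj (g x) * of_real (p x))"
    unfolding l2_inner_def kernel_op_def by (simp only: infsum_cmult_left')
  also have "\<dots> = (\<Sum>\<^sub>\<infinity>y. \<Sum>\<^sub>\<infinity>x. of_real (K x y) * f y * cnj (g x) * of_real (p x))"
    by (rule infsum_swap_banach[OF pair_summable[OF f g]])
  also have "\<dots> = (\<Sum>\<^sub>\<infinity>y. \<Sum>\<^sub>\<infinity>x. f y * of_real (p y) * cnj (of_real (time_reversal p K y x) * g x))"
  proof (intro infsum_cong)
    fix x y
    show "of_real (K x y) * f y * cnj (g x) * of_real (p x)
        = f y * of_real (p y) * cnj (of_real (time_reversal p K y x) * g x)"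
      using weight_pos[of y] by (simp add: time_reversal_def)
  qed
  also have "\<dots> = l2_inner p f (adj_op g)"
    unfolding l2_inner_def kernel_op_def
    by (simp only: infsum_cmult_right' infsum_cnj) (simp only: mult_ac)
  finally show ?thesis .
qed

lemma adjoint_row_summable:
  assumes g: "g \<in> l2 p"
  shows "(\<lambda>x. of_real (time_reversal p K y x) * g x) summable_on UNIV"
proof -
  have "(\<lambda>(y, x). of_real (K x y) * (if y = y' then 1 else 0) * cnj (g x) * of_real (p x))
      summable_on UNIV \<times> UNIV" for y'
    using summable_on_swap[THEN iffD1, OF pair_summable[OF indicator_mem g]] by simp
  from summable_on_SigmaD1[OF this, of y y]
  have "(\<lambda>x. of_real (K x y) * cnj (g x) * of_real (p x)) summable_on UNIV" by simp
  then have "(\<lambda>x. of_real (1 / p y) * cnj (of_real (K x y) * cnj (g x) * of_real (p x))) summable_on UNIV"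
    by (intro summable_on_cmult_right summable_on_cnj_iff[THEN iffD2])
  then show ?thesis by (simp add: time_reversal_def mult_ac)
qed

text \<open>
  The reference measure need not be invariant, so the time-reversal need not be a Markov kernel. Its
  boundedness comes by duality from that of \<open>K\<close>.
\<close>

lemma adjoint_bounded: "bounded_on (l2 p) adj_op"
proof -
  obtain C where C: "C \<ge> 0" "\<And>f. f \<in> l2 p \<Longrightarrow> l2_norm p (kernel_op K f) \<le> C * l2_norm p f"
    using bounded_on_obtain[OF bounded_l2] by blast
  have bound: "adj_op g \<in> l2 p \<and> l2_norm p (adj_op g) \<le> C * l2_norm p g" if g: "g \<in> l2 p" for g
  proof -
    have "(\<Sum>x\<in>F. (cmod (adj_op g x))\<^sup>2 * p x) \<le> (C * l2_norm p g)\<^sup>2" if F: "finite F" for F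
    proof -
      \<comment> \<open>Test the adjoint relation on the truncation of the image to F.\<close>
      define f where "f x = (if x \<in> F then adj_op g x else 0)" for x
      define S where "S = (\<Sum>x\<in>F. (cmod (adj_op g x))\<^sup>2 * p x)"
      have S0: "S \<ge> 0" unfolding S_def by (intro sum_nonneg term_nonneg)
      have f: "f \<in> l2 p" unfolding mem_l2_iff
        by (rule finite_nonzero_values_imp_summable_on, rule finite_subset[OF _ F]) (auto simp: f_def)
      have "((\<lambda>x. (cmod (f x))\<^sup>2 * p x) has_sum S) UNIV"
        unfolding S_def by (rule has_sum_finite_neutralI[OF F]) (auto simp: f_def)
      then have Nf: "(l2_norm p f)\<^sup>2 = S" unfolding norm_power2 by (rule infsumI)
      have "((\<lambda>x. f x * cnj (adj_op g x) * of_real (p x)) has_sum of_real S) UNIV"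
        unfolding S_def
        by (rule has_sum_finite_neutralI[OF F]) (auto simp: f_def complex_norm_square simp del: of_real_power)
      then have "of_real S = l2_inner p (kernel_op K f) g"
        unfolding adjoint[OF f g] unfolding l2_inner_def by (simp add: infsumI)
      then have "S \<le> l2_norm p (kernel_op K f) * l2_norm p g"
        using Cauchy_Schwarz[OF op_mem[OF f] g] S0 by (metis abs_of_nonneg norm_of_real)
      also have "\<dots> \<le> C * l2_norm p f * l2_norm p g" by (intro mult_right_mono C f) simp
      finally have "l2_norm p f * l2_norm p f \<le> (C * l2_norm p g) * l2_norm p f"
        using Nf by (simp add: power2_eq_square mult_ac)
      then have "l2_norm p f \<le> C * l2_norm p g"
        using C(1) by (cases "l2_norm p f = 0") (auto simp: order_less_le)
      then show ?thesis unfolding S_def[symmetric] Nf[symmetric] by (intro power_mono) auto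
    qed
    then show ?thesis using l2_of_finite_bound[of "C * l2_norm p g" "adj_op g"] C(1) by simp
  qed
  show ?thesis unfolding bounded_on_def
  proof (intro conjI ballI allI)
    fix f g a b assume f: "f \<in> l2 p" and g: "g \<in> l2 p"
    show "adj_op (\<lambda>x. a * f x + b * g x) = (\<lambda>x. a * adj_op f x + b * adj_op g x)"
    proof
      fix x
      let ?R = "\<lambda>y. complex_of_real (time_reversal p K x y)"
      have "adj_op (\<lambda>x. a * f x + b * g x) x = (\<Sum>\<^sub>\<infinity>y. a * (?R y * f y) + b * (?R y * g y))"
        unfolding kernel_op_def by (intro infsum_cong) (simp add: algebra_simps)
      also have "\<dots> = a * adj_op f x + b * adj_op g x"
        unfolding kernel_op_def
        by (subst infsum_add) (auto intro!: summable_on_cmult_right adjoint_row_summable f g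
            simp: infsum_cmult_right')
      finally show "adj_op (\<lambda>x. a * f x + b * g x) x = a * adj_op f x + b * adj_op g x" .
    qed
  qed (use bound in blast)+
qed

lemma kernel_pow_nonneg [simp]: "0 \<le> kernel_pow K n x y"
  by (induction n arbitrary: x) (auto intro!: infsum_nonneg)

lemma iterate_mem: "f \<in> l2 p \<Longrightarrow> (kernel_op K ^^ n) f \<in> l2 p"
  by (induction n) (auto intro: op_mem)

text \<open>
  Absolute convergence of the rows of the matrix power has to be carried along in the induction,
  as it licenses the interchange of summation in the next step.
\<close>

lemma kernel_pow_iterate_aux:
  assumes "f \<in> l2 p"
  shows "(\<lambda>y. kernel_pow K n x y * cmod (f y)) summable_on UNIV \<and>
    kernel_op (kernel_pow K n) f x = (kernel_op K ^^ n) f x"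
  using assms
proof (induction n arbitrary: f x)
  case 0
  have "((\<lambda>y. kernel_pow K 0 x y * cmod (f y)) has_sum cmod (f x)) UNIV"
    by (rule has_sum_finite_neutralI[of "{x}"]) auto
  moreover have "((\<lambda>y. of_real (kernel_pow K 0 x y) * f y) has_sum f x) UNIV"
    by (rule has_sum_finite_neutralI[of "{x}"]) auto
  ultimately show ?case by (auto simp: kernel_op_def has_sum_imp_summable infsumI)
next
  case (Suc n)
  note f = \<open>f \<in> l2 p\<close>
  define \<phi> where "\<phi> = (kernel_op K ^^ n) (\<lambda>y. of_real (cmod (f y)))"
  have \<phi>: "\<phi> \<in> l2 p" unfolding \<phi>_def by (intro iterate_mem modulus_mem f)
  have \<phi>_sum: "((\<lambda>y. kernel_pow K n z y * cmod (f y)) has_sum cmod (\<phi> z)) UNIV" for z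
  proof -
    have "\<phi> z = of_real (\<Sum>\<^sub>\<infinity>y. kernel_pow K n z y * cmod (f y))"
      using Suc.IH[OF modulus_mem[OF f], of z]
        infsum_complex_of_real[of "\<lambda>y. kernel_pow K n z y * cmod (f y)" UNIV]
      by (simp add: \<phi>_def kernel_op_def[of "kernel_pow K n"])
    moreover have "(\<Sum>\<^sub>\<infinity>y. kernel_pow K n z y * cmod (f y)) \<ge> 0" by (intro infsum_nonneg) simp
    ultimately show ?thesis using Suc.IH[OF f, of z] by simp
  qed
  have pairs: "(\<lambda>(z, y). K x z * kernel_pow K n z y * cmod (f y)) summable_on UNIV \<times> UNIV"
  proof (rule summable_on_SigmaI)
    show "((\<lambda>y. case (z, y) of (z, y) \<Rightarrow> K x z * kernel_pow K n z y * cmod (f y)) has_sum K x z * cmod (\<phi> z)) UNIV" for z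
      using has_sum_cmult_right[OF \<phi>_sum, of "K x z"] by (simp add: mult.assoc)
  qed (auto intro: row_summable[OF \<phi>])
  have "(\<lambda>(y, z). K x z * kernel_pow K n z y * cmod (f y)) summable_on UNIV \<times> UNIV"
    using summable_on_swap[THEN iffD1, OF pairs] by simp
  from summable_on_Sigma_banach[OF this]
  have 1: "(\<lambda>y. kernel_pow K (Suc n) x y * cmod (f y)) summable_on UNIV"
    by (simp add: infsum_cmult_left')
  have cpairs: "(\<lambda>(z, y). of_real (K x z * kernel_pow K n z y) * f y) summable_on UNIV \<times> UNIV"
    using pairs by - (rule abs_summable_summable, simp add: norm_mult case_prod_unfold)
  have "kernel_op (kernel_pow K (Suc n)) f x
      = (\<Sum>\<^sub>\<infinity>y. \<Sum>\<^sub>\<infinity>z. of_real (K x z * kernel_pow K n z y) * f y)"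
    unfolding kernel_op_def by (simp only: infsum_cmult_left' infsum_complex_of_real kernel_pow.simps)
  also have "\<dots> = (\<Sum>\<^sub>\<infinity>z. \<Sum>\<^sub>\<infinity>y. of_real (K x z * kernel_pow K n z y) * f y)"
    by (rule infsum_swap_banach[OF cpairs, symmetric])
  also have "\<dots> = (\<Sum>\<^sub>\<infinity>z. of_real (K x z) * kernel_op (kernel_pow K n) f z)"
    unfolding kernel_op_def by (simp add: mult.assoc infsum_cmult_right')
  also have "\<dots> = (kernel_op K ^^ Suc n) f x"
    by (simp add: conjunct2[OF Suc.IH[OF f]] kernel_op_def[of K "(kernel_op K ^^ n) f"])
  finally show ?case using 1 by blast
qed

lemma kernel_pow_iterate:
  "f \<in> l2 p \<Longrightarrow> kernel_op (kernel_pow K n) f = (kernel_op K ^^ n) f"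
  using kernel_pow_iterate_aux by blast

end

section \<open>Kernels with an invariant distribution\<close>

lemma nonneg_pair_has_sum:
  fixes f :: "'b \<Rightarrow> 'c \<Rightarrow> real"
  assumes "\<And>x. (f x has_sum g x) UNIV" "(g has_sum S) UNIV" "\<And>x y. 0 \<le> f x y"
  shows "((\<lambda>(x, y). f x y) has_sum S) (UNIV \<times> UNIV)"
  using assms by (intro has_sum_SigmaI[where g = g] summable_on_SigmaI[where g = g])
    (auto intro: has_sum_imp_summable)

locale stationary_kernel = bounded_kernel +
  assumes invariant: "invariant_distribution K p"
begin

lemma weight_sum: "(p has_sum 1) UNIV"
  and column_sum: "((\<lambda>x. p x * K x y) has_sum p y) UNIV"
  using invariant by (auto simp: invariant_distribution_def)

lemma one_mem: "(\<lambda>_. 1) \<in> l2 p"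
  using weight_sum by (simp add: mem_l2_iff has_sum_imp_summable)

lemma norm_one: "l2_norm p (\<lambda>_. 1) = 1"
  using infsumI[OF weight_sum] by (simp add: l2_norm_def)

lemma op_one: "kernel_op K (\<lambda>_. 1) = (\<lambda>_. 1)"
proof
  fix x show "kernel_op K (\<lambda>_. 1) x = 1"
    using infsum_complex_of_real[of "K x" UNIV] infsumI[OF row_sum[of x]] by (simp add: kernel_op_def)
qed

lemma adj_one: "adj_op (\<lambda>_. 1) = (\<lambda>_. 1)"
proof
  fix x
  have "((\<lambda>y. p y * K y x / p x) has_sum p x / p x) UNIV"
    by (intro has_sum_divide_const column_sum)
  then show "adj_op (\<lambda>_. 1) x = 1"
    using infsum_complex_of_real[of "\<lambda>y. p y * K y x / p x" UNIV] weight_pos[of x]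
    by (simp add: kernel_op_def time_reversal_def infsumI)
qed

lemmas adj_mem = bounded_onD(1)[OF adjoint_bounded]

lemma mean_op: "f \<in> l2 p \<Longrightarrow> l2_inner p (kernel_op K f) (\<lambda>_. 1) = l2_inner p f (\<lambda>_. 1)"
  using adjoint[OF _ one_mem] adj_one by simp

lemma mean_adj: "f \<in> l2 p \<Longrightarrow> l2_inner p (adj_op f) (\<lambda>_. 1) = l2_inner p f (\<lambda>_. 1)"
  using adjoint[OF one_mem, of f] op_one inner_commute by metis

lemma l2_0_closed: "closed_subspace (l2_0 p)"
  unfolding l2_0_def by (rule orthogonal_closed_subspace[OF one_mem])

lemma l2_0D: "f \<in> l2_0 p \<Longrightarrow> f \<in> l2 p" "f \<in> l2_0 p \<Longrightarrow> l2_inner p f (\<lambda>_. 1) = 0"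
  by (auto simp: l2_0_def)

lemma bounded_l2_0:
  assumes T: "bounded_on (l2 p) T"
    and mean: "\<And>f. f \<in> l2 p \<Longrightarrow> l2_inner p (T f) (\<lambda>_. 1) = l2_inner p f (\<lambda>_. 1)"
  shows "bounded_on (l2_0 p) T"
  unfolding bounded_on_def
proof (intro conjI ballI allI)
  show "T f \<in> l2_0 p" if "f \<in> l2_0 p" for f
    using that bounded_onD(1)[OF T] mean by (simp add: l2_0_def)
  show "T (\<lambda>x. a * f x + b * g x) = (\<lambda>x. a * T f x + b * T g x)" if "f \<in> l2_0 p" "g \<in> l2_0 p" for f g a b
    by (rule bounded_onD(2)[OF T that[THEN l2_0D(1)]])
  show "\<exists>C. \<forall>f\<in>l2_0 p. l2_norm p (T f) \<le> C * l2_norm p f"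
    using norm_on_le[OF l2_closed_subspace T] l2_0D(1) by blast
qed

lemma op_l2_0: "bounded_on (l2_0 p) (kernel_op K)"
  by (rule bounded_l2_0[OF bounded_l2]) (rule mean_op)

lemma adj_l2_0: "bounded_on (l2_0 p) adj_op"
  by (rule bounded_l2_0[OF adjoint_bounded]) (rule mean_adj)

text \<open>
  Conditional variance decomposition: for a stationary step from \<open>X\<close> to \<open>Y\<close>, the function \<open>K f\<close> at \<open>X\<close> is the
  conditional expectation of \<open>f Y\<close>. Both the contraction property and the case of equality are read
  off from it.
\<close>

lemma variance_identity:
  assumes f: "f \<in> l2 p"
  shows "((\<lambda>(x, y). p x * K x y * (cmod (f y - kernel_op K f x))\<^sup>2) has_sum
    (l2_norm p f)\<^sup>2 - (l2_norm p (kernel_op K f))\<^sup>2) (UNIV \<times> UNIV)"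
proof -
  define u where "u = kernel_op K f"
  have u: "u \<in> l2 p" unfolding u_def by (rule op_mem[OF f])
  have sq: "((\<lambda>x. (cmod (h x))\<^sup>2 * p x) has_sum (l2_norm p h)\<^sup>2) UNIV" if "h \<in> l2 p" for h
    using that unfolding norm_power2 mem_l2_iff by (rule has_sum_infsum)
  have "((\<lambda>(y, x). p x * K x y * (cmod (f y))\<^sup>2) has_sum (l2_norm p f)\<^sup>2) (UNIV \<times> UNIV)"
  proof (rule nonneg_pair_has_sum[OF _ sq[OF f]])
    show "((\<lambda>x. p x * K x y * (cmod (f y))\<^sup>2) has_sum (cmod (f y))\<^sup>2 * p y) UNIV" for y
      using has_sum_cmult_left[OF column_sum[of y], of "(cmod (f y))\<^sup>2"] by (simp add: mult_ac)
  qed (simp add: less_imp_le[OF weight_pos])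
  then have a: "((\<lambda>(x, y). p x * K x y * (cmod (f y))\<^sup>2) has_sum (l2_norm p f)\<^sup>2) (UNIV \<times> UNIV)"
    using has_sum_swap[THEN iffD1] by fastforce
  have c: "((\<lambda>(x, y). p x * K x y * (cmod (u x))\<^sup>2) has_sum (l2_norm p u)\<^sup>2) (UNIV \<times> UNIV)"
  proof (rule nonneg_pair_has_sum[OF _ sq[OF u]])
    show "((\<lambda>y. p x * K x y * (cmod (u x))\<^sup>2) has_sum (cmod (u x))\<^sup>2 * p x) UNIV" for x
      using has_sum_cmult_left[OF row_sum[of x], of "(cmod (u x))\<^sup>2 * p x"] by (simp add: mult_ac)
  qed (simp add: less_imp_le[OF weight_pos])
  have "l2_inner p u u
      = (\<Sum>\<^sub>\<infinity>x. \<Sum>\<^sub>\<infinity>y. of_real (K x y) * f y * cnj (u x) * of_real (p x))"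
    unfolding l2_inner_def
    by (subst (1) u_def) (simp only: kernel_op_def infsum_cmult_left')
  also have "\<dots> = (\<Sum>\<^sub>\<infinity>(x, y)\<in>UNIV \<times> UNIV. of_real (K x y) * f y * cnj (u x) * of_real (p x))"
    by (rule infsum_Sigma'_banach[OF pair_summable[OF f u]])
  finally have "((\<lambda>(x, y). of_real (K x y) * f y * cnj (u x) * of_real (p x)) has_sum
      of_real ((l2_norm p u)\<^sup>2)) (UNIV \<times> UNIV)"
    unfolding inner_self[OF u] using pair_summable[OF f u] by simp
  from has_sum_Re[OF this]
  have b: "((\<lambda>(x, y). p x * K x y * Re (f y * cnj (u x))) has_sum (l2_norm p u)\<^sup>2) (UNIV \<times> UNIV)"
    by (simp add: case_prod_unfold algebra_simps)
  have square: "(cmod (w - v))\<^sup>2 = (cmod w)\<^sup>2 + (cmod v)\<^sup>2 + -2 * Re (w * cnj v)" for v w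
    by (simp only: cmod_power2) (simp add: power2_eq_square algebra_simps)
  have expand: "(\<lambda>(x, y). p x * K x y * (cmod (f y - u x))\<^sup>2) =
      (\<lambda>z. (case z of (x, y) \<Rightarrow> p x * K x y * (cmod (f y))\<^sup>2) + (case z of (x, y) \<Rightarrow> p x * K x y * (cmod (u x))\<^sup>2)
        + -2 * (case z of (x, y) \<Rightarrow> p x * K x y * Re (f y * cnj (u x))))"
  proof (rule ext, clarify)
    fix x y
    show "p x * K x y * (cmod (f y - u x))\<^sup>2 = p x * K x y * (cmod (f y))\<^sup>2 + p x * K x y * (cmod (u x))\<^sup>2
        + -2 * (p x * K x y * Re (f y * cnj (u x)))"
      unfolding square by algebra
  qed
  have "((\<lambda>(x, y). p x * K x y * (cmod (f y - u x))\<^sup>2) has_sum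
      (l2_norm p f)\<^sup>2 + (l2_norm p u)\<^sup>2 + -2 * (l2_norm p u)\<^sup>2) (UNIV \<times> UNIV)"
    unfolding expand by (intro has_sum_add has_sum_cmult_right a b c)
  then show ?thesis unfolding u_def 
    by (elim back_subst[of "\<lambda>S. (_ has_sum S) _"]) linarith
qed

lemma contraction:
  assumes f: "f \<in> l2 p"
  shows "l2_norm p (kernel_op K f) \<le> l2_norm p f"
proof (rule power2_le_imp_le)
  have "0 \<le> (l2_norm p f)\<^sup>2 - (l2_norm p (kernel_op K f))\<^sup>2"
    using variance_identity[OF f] by (rule has_sum_nonneg) (auto simp: less_imp_le[OF weight_pos])
  then show "(l2_norm p (kernel_op K f))\<^sup>2 \<le> (l2_norm p f)\<^sup>2" by simp
qed simp

text \<open>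
  If applying \<open>K\<close> loses no norm, the conditional variance vanishes: along an edge with positive
  probability the value of \<open>f\<close> is determined by the starting point.
\<close>

lemma isometric_imp_transported:
  assumes f: "f \<in> l2 p" and eq: "l2_norm p (kernel_op K f) = l2_norm p f" and edge: "K x y > 0"
  shows "f y = kernel_op K f x"
proof -
  have "(case (x, y) of (x, y) \<Rightarrow> p x * K x y * (cmod (f y - kernel_op K f x))\<^sup>2) = 0"
    by (rule nonneg_has_sum_le_0D[OF variance_identity[OF f]])
      (auto simp: eq less_imp_le[OF weight_pos])
  then show ?thesis using weight_pos[of x] edge by simp
qed

text \<open>
  From \<open>\<parallel>K* f\<parallel>^2 = \<langle>K K* f, f\<rangle>\<close> and the contraction property of \<open>K\<close>.
\<close>

lemma adj_contraction:
  assumes f: "f \<in> l2 p"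
  shows "l2_norm p (adj_op f) \<le> l2_norm p f"
proof -
  let ?g = "adj_op f"
  have g: "?g \<in> l2 p" by (rule adj_mem[OF f])
  have "of_real ((l2_norm p ?g)\<^sup>2) = l2_inner p (kernel_op K ?g) f"
    using adjoint[OF g f] inner_self[OF g] by simp
  then have "(l2_norm p ?g)\<^sup>2 \<le> l2_norm p (kernel_op K ?g) * l2_norm p f"
    using Cauchy_Schwarz[OF op_mem[OF g] f] by (metis abs_power2 norm_of_real)
  also have "\<dots> \<le> l2_norm p ?g * l2_norm p f" by (intro mult_right_mono contraction g) simp
  finally have "l2_norm p ?g * l2_norm p ?g \<le> l2_norm p f * l2_norm p ?g"
    by (simp add: power2_eq_square mult_ac)
  then show ?thesis by (cases "l2_norm p ?g = 0") (auto simp: order_less_le)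
qed

lemma inner_indicator: "l2_inner p f (\<lambda>z. if z = x then 1 else 0) = f x * of_real (p x)"
proof -
  have "((\<lambda>z. f z * cnj (if z = x then 1 else 0) * complex_of_real (p z)) has_sum f x * of_real (p x)) UNIV"
    by (rule has_sum_finite_neutralI[of "{x}"]) auto
  then show ?thesis by (simp add: l2_inner_def infsumI)
qed

lemma norm_indicator: "(l2_norm p (\<lambda>z. if z = x then 1 else 0))\<^sup>2 = p x"
  using inner_self[OF indicator_mem[of x]] inner_indicator[of "\<lambda>z. if z = x then 1 else 0" x]
  by (simp flip: of_real_power)

text \<open>
  The Riesz representer of evaluation at \<open>x\<close> on the functions of mean zero.
\<close>

definition evaluator :: "'a \<Rightarrow> 'a \<Rightarrow> complex" where
  "evaluator x = (\<lambda>z. of_real (1 / p x) * (if z = x then 1 else 0) - 1)"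

lemma evaluator_mem: "evaluator x \<in> l2 p"
  unfolding evaluator_def by (rule diff_mem[OF scale_mem[OF indicator_mem] one_mem])

lemma inner_evaluator:
  assumes "f \<in> l2 p"
  shows "l2_inner p f (evaluator x) = f x - l2_inner p f (\<lambda>_. 1)"
  using inner_lincomb_right[OF indicator_mem[of x] one_mem assms, of "of_real (1 / p x)" "-1"]
    inner_indicator[of f x] weight_pos[of x]
  by (simp add: evaluator_def)

lemma evaluator_l2_0: "evaluator x \<in> l2_0 p"
proof -
  have "l2_inner p (\<lambda>_. 1) (evaluator x) = 0"
    using inner_evaluator[OF one_mem, of x] inner_self[OF one_mem] by (simp add: norm_one)
  then show ?thesis
    using inner_commute[of "evaluator x" "\<lambda>_. 1"] evaluator_mem by (simp add: l2_0_def)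
qed

lemma norm_evaluator: "(l2_norm p (evaluator x))\<^sup>2 = 1 / p x - 1"
proof -
  have "complex_of_real ((l2_norm p (evaluator x))\<^sup>2) = of_real (1 / p x - 1)"
    using inner_self[OF evaluator_mem] inner_evaluator[OF evaluator_mem] l2_0D(2)[OF evaluator_l2_0]
    by (simp add: evaluator_def)
  then show ?thesis using of_real_eq_iff by blast
qed

lemma l2_0_nontrivial:
  assumes "x \<noteq> (y :: 'a)"
  shows "\<exists>f\<in>l2_0 p. f \<noteq> (\<lambda>_. 0)"
  using evaluator_l2_0[of x] assms by (intro bexI[of _ "evaluator x"]) (auto simp: evaluator_def fun_eq_iff)

lemma centering:
  assumes f: "f \<in> l2 p"
  shows "(\<lambda>x. f x - l2_inner p f (\<lambda>_. 1)) \<in> l2_0 p"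
    and "l2_norm p (\<lambda>x. f x - l2_inner p f (\<lambda>_. 1)) \<le> l2_norm p f"
proof -
  define m where "m = l2_inner p f (\<lambda>_. 1)"
  define g where "g = (\<lambda>x. 1 * f x + (- m) * 1)"
  have g: "g \<in> l2 p" unfolding g_def by (rule lincomb_mem[OF f one_mem])
  have mean: "l2_inner p g (\<lambda>_. 1) = 0"
    unfolding g_def inner_lincomb_left[OF f one_mem one_mem] using inner_self[OF one_mem]
    by (simp add: m_def norm_one)
  have "of_real ((l2_norm p g)\<^sup>2) = l2_inner p g f"
    using inner_lincomb_right[OF f one_mem g, of 1 "- m"] mean inner_self[OF g] by (simp add: g_def)
  then have "(l2_norm p g)\<^sup>2 \<le> l2_norm p g * l2_norm p f"
    using Cauchy_Schwarz[OF g f] by (metis abs_power2 norm_of_real)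
  then have "l2_norm p g \<le> l2_norm p f"
    by (cases "l2_norm p g = 0") (auto simp: order_less_le power2_eq_square)
  moreover have eq: "(\<lambda>x. f x - l2_inner p f (\<lambda>_. 1)) = g" by (simp add: g_def m_def)
  ultimately show "l2_norm p (\<lambda>x. f x - l2_inner p f (\<lambda>_. 1)) \<le> l2_norm p f" by simp
  show "(\<lambda>x. f x - l2_inner p f (\<lambda>_. 1)) \<in> l2_0 p" unfolding eq using g mean by (simp add: l2_0_def)
qed

lemma pow_minus_stationary_eq:
  assumes f: "f \<in> l2 p"
  shows "pow_minus_stationary p K n f = (kernel_op K ^^ n) (\<lambda>x. f x - l2_inner p f (\<lambda>_. 1))"
proof -
  define m where "m = l2_inner p f (\<lambda>_. 1)"
  have "(kernel_op K ^^ n) (\<lambda>x. f x - m) = (\<lambda>x. (kernel_op K ^^ n) f x - m)"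
  proof (induction n)
    case (Suc n)
    then show ?case
      using bounded_onD(2)[OF bounded_l2 iterate_mem[OF f, of n] one_mem, of 1 "- m"] op_one by simp
  qed simp
  then show ?thesis
    unfolding pow_minus_stationary_def kernel_pow_iterate[OF f] by (simp add: m_def l2_inner_def)
qed

lemma pow_minus_stationary_bound:
  assumes c: "c \<ge> 0" and bound: "\<And>f. f \<in> l2_0 p \<Longrightarrow> l2_norm p ((kernel_op K ^^ n) f) \<le> c * l2_norm p f"
    and f: "f \<in> l2 p"
  shows "l2_norm p (pow_minus_stationary p K n f) \<le> c * l2_norm p f"
proof -
  have "l2_norm p (pow_minus_stationary p K n f) \<le> c * l2_norm p (\<lambda>x. f x - l2_inner p f (\<lambda>_. 1))"
    unfolding pow_minus_stationary_eq[OF f] by (rule bound[OF centering(1)[OF f]])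
  also have "\<dots> \<le> c * l2_norm p f" by (intro mult_left_mono centering(2) f c)
  finally show ?thesis .
qed

lemma iterate_l2_0: "f \<in> l2_0 p \<Longrightarrow> (kernel_op K ^^ n) f \<in> l2_0 p"
  using norm_on_iterate[OF l2_0_closed op_l2_0] by blast

lemma iterate_contraction: "f \<in> l2 p \<Longrightarrow> l2_norm p ((kernel_op K ^^ n) f) \<le> l2_norm p f"
proof (induction n)
  case (Suc n)
  then show ?case using contraction[OF iterate_mem[of f n]] by simp
qed simp

lemma op_norm_bound:
  assumes "c \<ge> 0" "\<And>f. f \<in> l2_0 p \<Longrightarrow> l2_norm p ((kernel_op K ^^ n) f) \<le> c * l2_norm p f"
  shows "op_norm p p (pow_minus_stationary p K n) \<le> c"
  unfolding op_norm_def
proof (rule cSUP_least)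
  show "{f \<in> l2 p. l2_norm p f \<le> 1} \<noteq> {}" using zero_mem norm_zero by fastforce
  fix f assume f: "f \<in> {f \<in> l2 p. l2_norm p f \<le> 1}"
  have "c * l2_norm p f \<le> c * 1" using f assms(1) by (intro mult_left_mono) auto
  then show "l2_norm p (pow_minus_stationary p K n f) \<le> c"
    using pow_minus_stationary_bound[OF assms, of f] f by auto
qed

lemma le_op_norm:
  assumes f: "f \<in> l2 p"
  shows "l2_norm p (pow_minus_stationary p K n f) \<le> op_norm p p (pow_minus_stationary p K n) * l2_norm p f"
  unfolding op_norm_def
proof (rule unit_ball_le[OF l2_closed_subspace _ _ f])
  show "l2_norm p (pow_minus_stationary p K n (\<lambda>x. a * f x)) = cmod a * l2_norm p (pow_minus_stationary p K n f)" for f a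
  proof -
    have "pow_minus_stationary p K n (\<lambda>x. a * f x) = (\<lambda>x. a * pow_minus_stationary p K n f x)"
      unfolding pow_minus_stationary_def kernel_op_def
      by (simp add: mult.left_commute[of _ a] mult.assoc[of a] infsum_cmult_right' right_diff_distrib)
    then show ?thesis by (simp add: norm_scale)
  qed
  show "l2_norm p (pow_minus_stationary p K n f) \<le> 1 * l2_norm p f" if "f \<in> l2 p" for f
    using that by (rule pow_minus_stationary_bound[rotated 2]) (auto intro: iterate_contraction l2_0D(1))
qed

lemma eigenvalue_power_le_op_norm:
  assumes f: "f \<in> l2_0 p" "f \<noteq> (\<lambda>_. 0)" and eig: "kernel_op K f = (\<lambda>x. z * f x)"
  shows "cmod z ^ n \<le> op_norm p p (pow_minus_stationary p K n)"
proof -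
  have "(kernel_op K ^^ n) f = (\<lambda>x. z ^ n * f x)"
  proof (induction n)
    case (Suc n)
    then show ?case using bounded_onD(3)[OF op_l2_0 f(1), of "z ^ n"] eig by (simp add: mult_ac)
  qed simp
  then have "cmod z ^ n * l2_norm p f \<le> op_norm p p (pow_minus_stationary p K n) * l2_norm p f"
    using le_op_norm[OF l2_0D(1)[OF f(1)], of n] pow_minus_stationary_eq[OF l2_0D(1)[OF f(1)], of n]
      l2_0D(2)[OF f(1)] by (simp add: norm_scale norm_power)
  then show ?thesis using norm_pos[OF l2_0D(1)[OF f(1)] f(2)] by simp
qed

text \<open>
  The left-hand side is the Rayleigh quotient, at the indicator of \<open>i\<close>, of \<open>K\<close> minus the stationary projection.
\<close>

lemma centered_diagonal_le_op_norm: "K i i - p i \<le> op_norm p p (pow_minus_stationary p K 1)"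
proof -
  let ?d = "\<lambda>z. if z = i then 1 else 0 :: complex"
  let ?u = "pow_minus_stationary p K 1 ?d"
  have Kd: "kernel_op K ?d i = of_real (K i i)"
    unfolding kernel_op_def by (rule infsumI, rule has_sum_finite_neutralI[of "{i}"]) auto
  have mean: "l2_inner p ?d (\<lambda>_. 1) = of_real (p i)"
    using inner_indicator[of "\<lambda>_. 1" i] inner_commute[of ?d "\<lambda>_. 1"] by simp
  have "?u = (\<lambda>x. kernel_op K ?d x - of_real (p i))"
    using bounded_onD(2)[OF bounded_l2 indicator_mem[of i] one_mem, of 1 "- of_real (p i)"] op_one
    by (simp add: pow_minus_stationary_eq[OF indicator_mem] mean)
  then have ui: "?u i = of_real (K i i - p i)" using Kd by simp
  have u: "?u \<in> l2 p"
    unfolding pow_minus_stationary_eq[OF indicator_mem]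
    by (intro iterate_mem l2_0D(1)[OF centering(1)] indicator_mem)
  have "(K i i - p i) * p i \<le> cmod (?u i * of_real (p i))"
    unfolding ui using weight_pos[of i] by (simp flip: of_real_diff of_real_mult add: abs_mult)
  also have "\<dots> \<le> l2_norm p ?u * l2_norm p ?d"
    using Cauchy_Schwarz[OF u indicator_mem[of i]] by (simp add: inner_indicator)
  also have "\<dots> \<le> op_norm p p (pow_minus_stationary p K 1) * l2_norm p ?d * l2_norm p ?d"
    by (intro mult_right_mono le_op_norm indicator_mem) simp
  also have "\<dots> = op_norm p p (pow_minus_stationary p K 1) * p i"
    using norm_indicator[of i] by (simp add: power2_eq_square mult.assoc)
  finally show ?thesis using weight_pos[of i] by simp
qed

text \<open>
  Twice the total variation distance is the value at \<open>x\<close> of \<open>K^n\<close> minus the stationary projection,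
  applied to the sign of the difference of the two measures, a function of norm one; this value is an inner product with
  the representer of evaluation at \<open>x\<close>.
\<close>

lemma total_variation_le_op_norm:
  assumes fin: "finite (UNIV :: 'a set)"
  shows "total_variation (kernel_pow K n x) p
    \<le> op_norm p p (pow_minus_stationary p K n) / 2 * sqrt (1 / p x - 1)"
proof -
  \<comment> \<open>The sign of the difference, with the value 1 where it vanishes so that the norm is exactly 1.\<close>
  define s where "s y = (if p y \<le> kernel_pow K n x y then 1 else - 1 :: complex)" for y
  have s: "s \<in> l2 p" using fin by (auto simp: mem_l2_iff intro: summable_on_finite)
  have Ns: "l2_norm p s = 1"
  proof -
    have "(cmod (s y))\<^sup>2 = 1" for y by (simp add: s_def)
    then show ?thesis using infsumI[OF weight_sum] by (simp add: l2_norm_def)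
  qed
  let ?u = "pow_minus_stationary p K n s"
  have u: "?u \<in> l2_0 p"
    unfolding pow_minus_stationary_eq[OF s] by (intro iterate_l2_0 centering s)
  have "?u x = (\<Sum>y\<in>UNIV. of_real (kernel_pow K n x y) * s y - s y * of_real (p y))"
    using fin by (simp add: pow_minus_stationary_def kernel_op_def sum_subtractf)
  also have "\<dots> = (\<Sum>y\<in>UNIV. of_real \<bar>kernel_pow K n x y - p y\<bar>)"
    by (intro sum.cong) (auto simp: s_def)
  finally have "?u x = of_real (2 * total_variation (kernel_pow K n x) p)"
    using fin by (simp add: total_variation_def)
  then have "2 * total_variation (kernel_pow K n x) p \<le> cmod (l2_inner p ?u (evaluator x))"
    using inner_evaluator[OF l2_0D(1)[OF u], of x] l2_0D(2)[OF u]
    by (simp only: diff_0_right norm_of_real abs_ge_self)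
  also have "\<dots> \<le> l2_norm p ?u * l2_norm p (evaluator x)"
    by (rule Cauchy_Schwarz[OF l2_0D(1)[OF u] evaluator_mem])
  also have "\<dots> \<le> op_norm p p (pow_minus_stationary p K n) * l2_norm p (evaluator x)"
    using le_op_norm[OF s, of n] Ns by (intro mult_right_mono) auto
  also have "l2_norm p (evaluator x) = sqrt (1 / p x - 1)"
    by (simp flip: norm_evaluator)
  finally show ?thesis by simp
qed

text \<open>
  Apply \<open>normal_eigenvector\<close> to the self-adjoint compact operator \<open>K K*\<close> on the functions of mean zero:
  its norm is attained at an eigenvalue, hence equals its spectral radius \<open>sigma_star^2\<close>. Then
  \<open>\<parallel>K* g\<parallel>^2 = \<langle>K K* g, g\<rangle> \<le> sigma_star^2 \<parallel>g\<parallel>^2\<close>, and \<open>K\<close> has the same norm as its adjoint. The eigenfunction in the last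
  conclusion shows that \<open>sigma_star\<close> vanishes when \<open>K\<close> does on this space.
\<close>

lemma sigma_star_bound:
  assumes compact: "compact_op p p (kernel_op K)" and nontriv: "x0 \<noteq> (y0 :: 'a)"
  shows "sigma_star p K \<ge> 0" "f \<in> l2_0 p \<Longrightarrow> l2_norm p (kernel_op K f) \<le> sigma_star p K * l2_norm p f"
    "\<exists>k\<in>l2_0 p. k \<noteq> (\<lambda>_. 0) \<and> l2_norm p (kernel_op K (adj_op k)) = (sigma_star p K)\<^sup>2 * l2_norm p k"
proof -
  let ?T = "kernel_op K \<circ> adj_op"
  note closed = l2_0_closed
  note adj0 = bounded_onD(1)[OF adj_l2_0]
  have T: "bounded_on (l2_0 p) ?T" unfolding bounded_on_def
  proof (intro conjI ballI allI)
    show "?T f \<in> l2_0 p" if "f \<in> l2_0 p" for f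
      using that bounded_onD(1)[OF op_l2_0] adj0 by simp
    show "?T (\<lambda>x. a * f x + b * g x) = (\<lambda>x. a * ?T f x + b * ?T g x)" if "f \<in> l2_0 p" "g \<in> l2_0 p" for f g a b
      using bounded_onD(2)[OF adj_l2_0 that] bounded_onD(2)[OF op_l2_0 adj0[OF that(1)] adj0[OF that(2)]]
      by simp
    have "l2_norm p (?T f) \<le> 1 * l2_norm p f" if "f \<in> l2_0 p" for f
      using contraction[OF adj_mem] adj_contraction l2_0D(1)[OF that] by fastforce
    then show "\<exists>C. \<forall>f\<in>l2_0 p. l2_norm p (?T f) \<le> C * l2_norm p f" by blast
  qed
  have TT: "l2_inner p (?T f) g = l2_inner p (adj_op f) (adj_op g)" if "f \<in> l2 p" "g \<in> l2 p" for f g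
    by (simp only: o_apply adjoint[OF adj_mem[OF that(1)] that(2)])
  have self: "l2_inner p (?T f) g = l2_inner p f (?T g)" if "f \<in> l2_0 p" "g \<in> l2_0 p" for f g
    unfolding TT[OF that[THEN l2_0D(1)]] inner_commute[of f "?T g"] TT[OF that(2,1)[THEN l2_0D(1)]]
    by (rule inner_commute)
  have comp: "compact_on (l2_0 p) ?T" unfolding compact_on_def
  proof (intro allI impI)
    fix f assume f: "\<forall>n::nat. f n \<in> l2_0 p \<and> l2_norm p (f n) \<le> 1"
    then have "\<forall>n. adj_op (f n) \<in> l2 p \<and> l2_norm p (adj_op (f n)) \<le> 1"
      using adj_mem adj_contraction l2_0D(1) by (meson order_trans)
    then obtain g r where g: "g \<in> l2 p" "strict_mono r"
        "(\<lambda>n. l2_norm p (\<lambda>x. kernel_op K (adj_op (f (r n))) x - g x)) \<longlonglongrightarrow> 0"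
      using conjunct2[OF compact[unfolded compact_op_def], rule_format, of "\<lambda>n. adj_op (f n)"] by blast
    have "g \<in> l2_0 p"
      by (rule closed_subspaceD(7)[OF closed _ g(1,3)]) (use f bounded_onD(1)[OF T] in auto)
    then show "\<exists>g\<in>l2_0 p. \<exists>r. strict_mono r \<and> (\<lambda>n. l2_norm p (\<lambda>x. ?T (f (r n)) x - g x)) \<longlonglongrightarrow> 0"
      using g by auto
  qed
  obtain e0 where e0: "e0 \<in> l2_0 p" "e0 \<noteq> (\<lambda>_. 0)" using l2_0_nontrivial[OF nontriv] by blast
  obtain z k where k: "k \<in> l2_0 p" "k \<noteq> (\<lambda>_. 0)" "?T k = (\<lambda>x. z * k x)" "cmod z = norm_on (l2_0 p) ?T"
    using normal_eigenvector[OF closed e0 T T self refl comp] by blast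
  have "lambda_star p ?T = cmod z" unfolding lambda_star_def
    using norm_on_iterate[OF closed T] k(4)
    by (intro spectral_radius_eqI[OF closed T, of 1 z k] k(1-3)) auto
  then have sig: "sigma_star p K = sqrt (norm_on (l2_0 p) ?T)" by (simp add: sigma_star_def k(4))
  show pos: "sigma_star p K \<ge> 0" unfolding sig by (intro real_sqrt_ge_zero norm_on_nonneg[OF closed T])
  have sig2: "(sigma_star p K)\<^sup>2 = norm_on (l2_0 p) ?T"
    unfolding sig by (intro real_sqrt_pow2 norm_on_nonneg[OF closed T])
  have "l2_norm p (kernel_op K (adj_op k)) = (sigma_star p K)\<^sup>2 * l2_norm p k"
    using k(3) by (simp add: sig2 norm_scale k(4)[symmetric])
  then show "\<exists>k\<in>l2_0 p. k \<noteq> (\<lambda>_. 0) \<and> l2_norm p (kernel_op K (adj_op k)) = (sigma_star p K)\<^sup>2 * l2_norm p k"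
    using k(1,2) by blast
  have adj_bound: "l2_norm p (adj_op g) \<le> sigma_star p K * l2_norm p g" if g: "g \<in> l2_0 p" for g
  proof (rule power2_le_imp_le)
    have "of_real ((l2_norm p (adj_op g))\<^sup>2) = l2_inner p (?T g) g"
      using TT inner_self adj_mem l2_0D(1)[OF g] by simp
    then have "(l2_norm p (adj_op g))\<^sup>2 \<le> l2_norm p (?T g) * l2_norm p g"
      using Cauchy_Schwarz[OF l2_0D(1)[OF bounded_onD(1)[OF T g]] l2_0D(1)[OF g]]
      by (metis abs_power2 norm_of_real)
    also have "\<dots> \<le> (norm_on (l2_0 p) ?T * l2_norm p g) * l2_norm p g"
      by (intro mult_right_mono norm_on_le[OF closed T g]) simp
    finally show "(l2_norm p (adj_op g))\<^sup>2 \<le> (sigma_star p K * l2_norm p g)\<^sup>2"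
      by (simp add: power_mult_distrib sig2) (simp add: power2_eq_square mult_ac)
  qed (use pos in simp)
  show "l2_norm p (kernel_op K f) \<le> sigma_star p K * l2_norm p f" if f: "f \<in> l2_0 p"
  proof -
    let ?g = "kernel_op K f"
    have g: "?g \<in> l2_0 p" by (rule bounded_onD(1)[OF op_l2_0 f])
    have "of_real ((l2_norm p ?g)\<^sup>2) = l2_inner p f (adj_op ?g)"
      using adjoint[OF l2_0D(1)[OF f] l2_0D(1)[OF g]] inner_self[OF l2_0D(1)[OF g]] by simp
    then have "(l2_norm p ?g)\<^sup>2 \<le> l2_norm p f * l2_norm p (adj_op ?g)"
      using Cauchy_Schwarz[OF l2_0D(1)[OF f] adj_mem[OF l2_0D(1)[OF g]]]
      by (metis abs_power2 norm_of_real)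
    also have "\<dots> \<le> l2_norm p f * (sigma_star p K * l2_norm p ?g)"
      by (intro mult_left_mono adj_bound g) simp
    finally have "l2_norm p ?g * l2_norm p ?g \<le> (sigma_star p K * l2_norm p f) * l2_norm p ?g"
      by (simp add: power2_eq_square mult_ac)
    then show ?thesis using pos by (cases "l2_norm p ?g = 0") (auto simp: order_less_le)
  qed
qed

lemma power_bound:
  assumes "s \<ge> 0" "\<And>f. f \<in> l2_0 p \<Longrightarrow> l2_norm p (kernel_op K f) \<le> s * l2_norm p f" "f \<in> l2_0 p"
  shows "(kernel_op K ^^ n) f \<in> l2_0 p \<and> l2_norm p ((kernel_op K ^^ n) f) \<le> s ^ n * l2_norm p f"
proof (induction n)
  case (Suc n)
  have "l2_norm p ((kernel_op K ^^ Suc n) f) \<le> s * l2_norm p ((kernel_op K ^^ n) f)"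
    using assms(2) Suc by simp
  also have "\<dots> \<le> s * (s ^ n * l2_norm p f)" using Suc assms(1) by (intro mult_left_mono) auto
  finally show ?case using Suc bounded_onD(1)[OF op_l2_0] by (simp add: mult_ac)
qed (use assms(3) in simp)

end

section \<open>Ergodicity and the unit circle\<close>

text \<open>
  The least positive exponent that sends \<open>z\<close> to 1 divides every other such exponent.
\<close>

lemma root_of_unity_eq_1:
  fixes z :: complex
  assumes "\<And>n. n \<in> S \<Longrightarrow> z ^ n = 1" "Gcd S = 1" "0 \<notin> S"
  shows "z = 1"
proof -
  have "\<exists>n. n > 0 \<and> z ^ n = 1"
  proof (cases "S = {}")
    case False
    then obtain n where "n \<in> S" by blast
    then show ?thesis using assms(1,3) by (metis gr0I)
  qed (use assms(2) in simp)
  define d where "d = (LEAST n. n > 0 \<and> z ^ n = 1)"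
  have d: "d > 0" "z ^ d = 1"
    using LeastI_ex[OF \<open>\<exists>n. n > 0 \<and> z ^ n = 1\<close>] by (auto simp: d_def)
  have least: "d \<le> n" if "n > 0" "z ^ n = 1" for n
    using that unfolding d_def by (intro Least_le) auto
  have "d dvd n" if n: "n \<in> S" for n
  proof -
    have "z ^ (d * (n div d) + n mod d) = 1" using assms(1)[OF n] by simp
    then have "z ^ (n mod d) = 1" by (simp only: power_add power_mult d(2)) simp
    then show ?thesis using least[of "n mod d"] d(1) by (meson leD mod_less_divisor gr0I mod_0_imp_dvd)
  qed
  then have "d dvd Gcd S" by (rule Gcd_greatest)
  then show ?thesis using assms(2) d(2) by simp
qed

locale ergodic_stationary_kernel = stationary_kernel +
  assumes irreducible: "irreducible_kernel K" and aperiodic: "aperiodic_kernel K"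
begin

text \<open>
  As \<open>K\<close> is a contraction, \<open>\<bar>z\<bar> = 1\<close> and no norm is lost, so \<open>f y = z^n f x\<close> whenever \<open>y\<close> can be reached from
  \<open>x\<close> in \<open>n\<close> steps. Return times to a point where \<open>f\<close> does not vanish make \<open>z^n = 1\<close>, and aperiodicity
  leaves only \<open>z = 1\<close>; irreducibility then makes \<open>f\<close> constant.
\<close>

lemma peripheral_eigenfunction:
  assumes f: "f \<in> l2 p" "f \<noteq> (\<lambda>_. 0)" and eig: "kernel_op K f = (\<lambda>x. z * f x)" and z: "cmod z \<ge> 1"
  shows "\<exists>c. f = (\<lambda>_. c)"
proof -
  have "cmod z * l2_norm p f \<le> 1 * l2_norm p f"
    using contraction[OF f(1)] unfolding eig norm_scale by simp
  then have z1: "cmod z = 1" using norm_pos[OF f] z by simp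
  then have iso: "l2_norm p (kernel_op K f) = l2_norm p f" unfolding eig norm_scale by simp
  have transport: "f y = z ^ n * f x" if "kernel_pow K n x y > 0" for n x y
    using that
  proof (induction n arbitrary: x)
    case 0
    then show ?case by (simp split: if_splits)
  next
    case (Suc n)
    have "\<exists>w. K x w * kernel_pow K n w y \<noteq> 0"
    proof (rule ccontr)
      assume "\<nexists>w. K x w * kernel_pow K n w y \<noteq> 0"
      then have "(\<Sum>\<^sub>\<infinity>w. K x w * kernel_pow K n w y) = 0" by (intro infsum_0) auto
      then show False using Suc.prems by simp
    qed
    then obtain w where "K x w > 0" "kernel_pow K n w y > 0"
      using kernel_nonneg kernel_pow_nonneg by (metis mult_eq_0_iff order_le_less)
    then show ?case
      using Suc.IH[of w] isometric_imp_transported[OF f(1) iso, of x w] by (simp add: eig mult_ac)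
  qed
  obtain x0 where x0: "f x0 \<noteq> 0" using f(2) by auto
  have "z = 1"
  proof (rule root_of_unity_eq_1)
    show "z ^ n = 1" if "n \<in> {n. n > 0 \<and> kernel_pow K n x0 x0 > 0}" for n
      using transport[of n x0 x0] that x0 by simp
    show "Gcd {n. n > 0 \<and> kernel_pow K n x0 x0 > 0} = 1"
      using aperiodic by (simp add: aperiodic_kernel_def)
  qed simp
  then have "f y = f x0" for y
    using transport[of _ x0 y] irreducible unfolding irreducible_kernel_def by (metis mult_1 power_one)
  then show ?thesis by auto
qed

end

section \<open>Similarity with a normal kernel\<close>

locale normal_similarity =
  P: ergodic_stationary_kernel p P + Q: bounded_kernel q Q
  for p q :: "'a \<Rightarrow> real" and P Q +
  fixes \<Lambda> :: "('a \<Rightarrow> complex) \<Rightarrow> ('a \<Rightarrow> complex)"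
  assumes normal: "normal_kernel q Q"
    and similar: "similar_kernels p P \<Lambda> q Q"
    and compact: "compact_op p p (kernel_op P)"
    and nontrivial: "\<exists>x y :: 'a. x \<noteq> y"
begin

abbreviation "\<Lambda>' \<equiv> l2_inverse q \<Lambda>"
abbreviation "kap \<equiv> condition_number p q \<Lambda>"
abbreviation "lam \<equiv> lambda_star p (kernel_op P)"
abbreviation "sig \<equiv> sigma_star p P"

lemma \<Lambda>_bounded: "bounded_op q p \<Lambda>" and \<Lambda>'_bounded: "bounded_op p q \<Lambda>'"
  and intertwine: "f \<in> l2 q \<Longrightarrow> kernel_op P (\<Lambda> f) = \<Lambda> (kernel_op Q f)"
  and bij: "bij_betw \<Lambda> (l2 q) (l2 p)"
  using similar by (auto simp: similar_kernels_def)

lemma \<Lambda>_mem: "f \<in> l2 q \<Longrightarrow> \<Lambda> f \<in> l2 p" and \<Lambda>'_mem: "f \<in> l2 p \<Longrightarrow> \<Lambda>' f \<in> l2 q"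
  using \<Lambda>_bounded \<Lambda>'_bounded by (auto simp: bounded_op_def)

lemma \<Lambda>_\<Lambda>': "f \<in> l2 p \<Longrightarrow> \<Lambda> (\<Lambda>' f) = f" and \<Lambda>'_\<Lambda>: "g \<in> l2 q \<Longrightarrow> \<Lambda>' (\<Lambda> g) = g"
  using bij by (auto simp: l2_inverse_def bij_betw_def inv_into_f_f f_inv_into_f)

lemma \<Lambda>_lin: "f \<in> l2 q \<Longrightarrow> g \<in> l2 q \<Longrightarrow> \<Lambda> (\<lambda>x. a * f x + b * g x) = (\<lambda>x. a * \<Lambda> f x + b * \<Lambda> g x)"
  using \<Lambda>_bounded unfolding bounded_op_def by blast

lemma \<Lambda>_scale: "f \<in> l2 q \<Longrightarrow> \<Lambda> (\<lambda>x. a * f x) = (\<lambda>x. a * \<Lambda> f x)"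
  using \<Lambda>_lin[of f f a 0] by simp

lemma \<Lambda>'_lin: "f \<in> l2 p \<Longrightarrow> g \<in> l2 p \<Longrightarrow> \<Lambda>' (\<lambda>x. a * f x + b * g x) = (\<lambda>x. a * \<Lambda>' f x + b * \<Lambda>' g x)"
  using \<Lambda>'_bounded unfolding bounded_op_def by blast

lemmas \<Lambda>_norm = op_norm_le[OF Q.pos_weight_axioms P.pos_weight_axioms \<Lambda>_bounded]
lemmas \<Lambda>'_norm = op_norm_le[OF P.pos_weight_axioms Q.pos_weight_axioms \<Lambda>'_bounded]

lemma kap_nonneg: "kap \<ge> 0"
  unfolding condition_number_def using \<Lambda>_norm(2) \<Lambda>'_norm(2) by simp

lemma norm_le_kap:
  assumes f: "f \<in> l2 p" and T: "T (\<Lambda>' f) \<in> l2 q" "l2_norm q (T (\<Lambda>' f)) \<le> c * l2_norm q (\<Lambda>' f)" "c \<ge> 0"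
  shows "l2_norm p (\<Lambda> (T (\<Lambda>' f))) \<le> kap * c * l2_norm p f"
proof -
  have "l2_norm p (\<Lambda> (T (\<Lambda>' f))) \<le> op_norm q p \<Lambda> * l2_norm q (T (\<Lambda>' f))"
    by (rule \<Lambda>_norm(1)[OF T(1)])
  also have "\<dots> \<le> op_norm q p \<Lambda> * (c * (op_norm p q \<Lambda>' * l2_norm p f))"
    using T(2,3) mult_left_mono[OF \<Lambda>'_norm(1)[OF f] T(3)] by (intro mult_left_mono \<Lambda>_norm(2)) linarith
  finally show ?thesis by (simp add: condition_number_def mult_ac)
qed

lemma kap_ge_1: "kap \<ge> 1"
  using norm_le_kap[OF P.one_mem, of id 1] by (simp add: \<Lambda>'_mem P.one_mem \<Lambda>_\<Lambda>' P.norm_one)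

lemma commute: "f \<in> l2 q \<Longrightarrow> kernel_op Q (Q.adj_op f) = Q.adj_op (kernel_op Q f)"
  using normal by (simp add: normal_kernel_def)

text \<open>
  The fixed function of \<open>Q\<close> that corresponds to the constant functions.
\<close>

definition e where "e = \<Lambda>' (\<lambda>_. 1)"

lemma e_mem: "e \<in> l2 q" and \<Lambda>_e: "\<Lambda> e = (\<lambda>_. 1)"
  using \<Lambda>'_mem[OF P.one_mem] \<Lambda>_\<Lambda>'[OF P.one_mem] by (auto simp: e_def)

lemma \<Lambda>_inj: "f \<in> l2 q \<Longrightarrow> g \<in> l2 q \<Longrightarrow> \<Lambda> f = \<Lambda> g \<Longrightarrow> f = g"
  by (metis \<Lambda>'_\<Lambda>)

lemma \<Lambda>_zero: "\<Lambda> (\<lambda>_. 0) = (\<lambda>_. 0)"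
  using \<Lambda>_scale[OF e_mem, of 0] by simp

lemma e_nonzero: "e \<noteq> (\<lambda>_. 0)"
  using \<Lambda>_e \<Lambda>_zero by (metis zero_neq_one)

lemma Q_e: "kernel_op Q e = e"
  by (rule \<Lambda>_inj[OF Q.op_mem[OF e_mem] e_mem])
    (simp add: intertwine[OF e_mem, symmetric] \<Lambda>_e P.op_one)

text \<open>
  \<open>Q - 1\<close> is normal, so it has the same kernel as its adjoint: \<open>\<parallel>Q* e - e\<parallel> = \<parallel>Q e - e\<parallel> = 0\<close>.
\<close>

lemma adj_e: "Q.adj_op e = e"
proof -
  have adj: "Q.adj_op e \<in> l2 q" by (rule Q.bounded_onD(1)[OF Q.adjoint_bounded e_mem])
  have "l2_inner q (Q.adj_op e) (Q.adj_op e) = l2_inner q (kernel_op Q (Q.adj_op e)) e"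
    using Q.adjoint[OF adj e_mem] by simp
  also have "\<dots> = l2_inner q e e"
    using commute[OF e_mem] Q.adjoint[OF e_mem e_mem] Q.inner_commute[of "Q.adj_op e" e] Q.inner_commute[of e e]
    by (simp add: Q_e)
  finally have 1: "(l2_norm q (Q.adj_op e))\<^sup>2 = (l2_norm q e)\<^sup>2"
    unfolding Q.inner_self[OF adj] Q.inner_self[OF e_mem] of_real_eq_iff .
  have 2: "l2_inner q e (Q.adj_op e) = of_real ((l2_norm q e)\<^sup>2)"
    using Q.adjoint[OF e_mem e_mem] Q.inner_self[OF e_mem] by (simp add: Q_e)
  have "(l2_norm q (\<lambda>x. 1 * e x + (-1) * Q.adj_op e x))\<^sup>2 = 0"
    unfolding Q.norm_lincomb_power2[OF e_mem adj] 1 2 by simp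
  then have "(\<lambda>x. 1 * e x + (-1) * Q.adj_op e x) = (\<lambda>_. 0)"
    by (intro Q.norm_eq_0_imp Q.lincomb_mem e_mem adj) simp
  then show ?thesis by (auto simp: fun_eq_iff)
qed

definition W where "W = {f \<in> l2 q. l2_inner q f e = 0}"

lemma W_closed: "Q.closed_subspace W"
  unfolding W_def by (rule Q.orthogonal_closed_subspace[OF e_mem])

lemma W_D: "f \<in> W \<Longrightarrow> f \<in> l2 q" "f \<in> W \<Longrightarrow> l2_inner q f e = 0"
  by (auto simp: W_def)

lemma restrict_W:
  assumes T: "Q.bounded_on (l2 q) T" and mean: "\<And>f. f \<in> l2 q \<Longrightarrow> l2_inner q (T f) e = l2_inner q f e"
  shows "Q.bounded_on W T"
  unfolding Q.bounded_on_def
proof (intro conjI ballI allI)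
  show "T f \<in> W" if "f \<in> W" for f
    using that Q.bounded_onD(1)[OF T] mean by (simp add: W_def)
  show "T (\<lambda>x. a * f x + b * g x) = (\<lambda>x. a * T f x + b * T g x)" if "f \<in> W" "g \<in> W" for f g a b
    by (rule Q.bounded_onD(2)[OF T that[THEN W_D(1)]])
  show "\<exists>C. \<forall>f\<in>W. l2_norm q (T f) \<le> C * l2_norm q f"
    using Q.norm_on_le[OF Q.l2_closed_subspace T] W_D(1) by blast
qed

lemma Q_W: "Q.bounded_on W (kernel_op Q)"
  by (rule restrict_W[OF Q.bounded_l2]) (simp add: Q.adjoint e_mem adj_e)

lemma adj_W: "Q.bounded_on W Q.adj_op"
proof (rule restrict_W[OF Q.adjoint_bounded])
  fix f assume "f \<in> l2 q"
  then have "l2_inner q e (Q.adj_op f) = l2_inner q e f"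
    using Q.adjoint[OF e_mem, of f] by (simp add: Q_e)
  then show "l2_inner q (Q.adj_op f) e = l2_inner q f e" by (metis Q.inner_commute)
qed

text \<open>
  Otherwise all square-summable functions would be multiples of \<open>e\<close>, but the indicators of two
  different points are linearly independent.
\<close>

lemma W_nontrivial: "\<exists>f\<in>W. f \<noteq> (\<lambda>_. 0)"
proof (rule ccontr)
  assume trivial: "\<not> ?thesis"
  define N where "N = complex_of_real ((l2_norm q e)\<^sup>2)"
  have N: "N \<noteq> 0" "l2_inner q e e = N"
    using Q.norm_pos[OF e_mem e_nonzero] Q.inner_self[OF e_mem] by (auto simp: N_def)
  have span: "\<exists>c. f = (\<lambda>x. c * e x)" if f: "f \<in> l2 q" for f
  proof -
    define c where "c = l2_inner q f e / N"
    have "l2_inner q (\<lambda>x. 1 * f x + (- c) * e x) e = 0"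
      unfolding Q.inner_lincomb_left[OF f e_mem e_mem] N(2) using N(1) by (simp add: c_def)
    then have "(\<lambda>x. 1 * f x + (- c) * e x) \<in> W"
      using Q.lincomb_mem[OF f e_mem, of 1 "- c"] by (simp add: W_def)
    then have "(\<lambda>x. 1 * f x + (- c) * e x) = (\<lambda>_. 0)" using trivial by blast
    then have "f = (\<lambda>x. c * e x)" by (auto simp: fun_eq_iff)
    then show ?thesis ..
  qed
  obtain x y :: 'a where xy: "x \<noteq> y" using nontrivial by blast
  obtain c d where c: "(\<lambda>z. if z = x then 1 else 0) = (\<lambda>z. c * e z)" and d: "(\<lambda>z. if z = y then 1 else 0) = (\<lambda>z. d * e z)"
    using span[OF Q.indicator_mem] by metis
  show False using fun_cong[OF c, of x] fun_cong[OF c, of y] fun_cong[OF d, of y] xy by auto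
qed

text \<open>
  Transport a bounded sequence by \<open>\<Lambda>\<close>, use compactness of \<open>P\<close>, and return by the inverse of \<open>\<Lambda>\<close>; the factor
  \<open>M\<close> brings the transported sequence back into the unit ball.
\<close>

lemma compact_W: "Q.compact_on W (kernel_op Q)"
  unfolding Q.compact_on_def
proof (intro allI impI)
  fix f assume f: "\<forall>n::nat. f n \<in> W \<and> l2_norm q (f n) \<le> 1"
  define M where "M = op_norm q p \<Lambda> + 1"
  have M: "M > 0" using \<Lambda>_norm(2) by (simp add: M_def)
  have fq: "f n \<in> l2 q" for n using f W_D(1) by blast
  define h where "h n = (\<lambda>x. of_real (1 / M) * \<Lambda> (f n) x)" for n
  have h: "h n \<in> l2 p" "l2_norm p (h n) \<le> 1" for n
  proof -
    show "h n \<in> l2 p" unfolding h_def by (intro P.scale_mem \<Lambda>_mem fq)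
    have "l2_norm p (\<Lambda> (f n)) \<le> op_norm q p \<Lambda> * 1"
      using \<Lambda>_norm(1)[OF fq[of n]] mult_left_mono[OF conjunct2[OF spec[OF f, of n]] \<Lambda>_norm(2)] by linarith
    then have "l2_norm p (\<Lambda> (f n)) \<le> M" by (simp add: M_def)
    then show "l2_norm p (h n) \<le> 1" unfolding h_def P.norm_scale norm_of_real using M by simp
  qed
  obtain g r where g: "g \<in> l2 p" "strict_mono r"
      "(\<lambda>n. l2_norm p (\<lambda>x. kernel_op P (h (r n)) x - g x)) \<longlonglongrightarrow> 0"
    using conjunct2[OF compact[unfolded compact_op_def], rule_format, of h] h by blast
  define u where "u = (\<lambda>x. of_real M * \<Lambda>' g x)"
  have u: "u \<in> l2 q" unfolding u_def by (intro Q.scale_mem \<Lambda>'_mem g)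
  have Ph: "\<Lambda>' (\<lambda>x. of_real M * kernel_op P (h n) x + - of_real M * g x) = (\<lambda>x. kernel_op Q (f n) x - u x)" for n
  proof -
    have "(\<lambda>x. of_real M * kernel_op P (h n) x) = kernel_op P (\<Lambda> (f n))"
      unfolding h_def P.bounded_onD(3)[OF P.bounded_l2 \<Lambda>_mem[OF fq]] using M by simp
    also have "\<dots> = \<Lambda> (kernel_op Q (f n))" by (rule intertwine[OF fq])
    finally have *: "\<Lambda>' (\<lambda>x. of_real M * kernel_op P (h n) x + 0 * g x) = kernel_op Q (f n)"
      using \<Lambda>'_\<Lambda>[OF Q.op_mem[OF fq]] by simp
    show ?thesis
      using * unfolding \<Lambda>'_lin[OF P.op_mem[OF h(1)] g(1)] u_def by (simp add: fun_eq_iff)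
  qed
  have "l2_norm q (\<lambda>x. kernel_op Q (f n) x - u x) \<le> op_norm p q \<Lambda>' * (M * l2_norm p (\<lambda>x. kernel_op P (h n) x - g x))" for n
  proof -
    have "l2_norm p (\<lambda>x. of_real M * kernel_op P (h n) x + - of_real M * g x)
        = l2_norm p (\<lambda>x. of_real M * (kernel_op P (h n) x - g x))" by (simp add: algebra_simps)
    also have "\<dots> = M * l2_norm p (\<lambda>x. kernel_op P (h n) x - g x)" using M by (simp add: P.norm_scale)
    finally show ?thesis
      using \<Lambda>'_norm(1)[OF P.lincomb_mem[OF P.op_mem[OF h(1)[of n]] g(1)], of "of_real M" "- of_real M"]
      unfolding Ph by simp
  qed
  note le = this
  have lim0: "(\<lambda>n. op_norm p q \<Lambda>' * (M * l2_norm p (\<lambda>x. kernel_op P (h (r n)) x - g x))) \<longlonglongrightarrow> 0"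
    by (intro tendsto_mult_right_zero g(3))
  have lim: "(\<lambda>n. l2_norm q (\<lambda>x. kernel_op Q (f (r n)) x - u x)) \<longlonglongrightarrow> 0"
    by (rule tendsto_sandwich[OF _ _ tendsto_const lim0]) (simp_all add: le)
  have "u \<in> W"
    by (rule Q.closed_subspaceD(7)[OF W_closed _ u lim]) (use f Q.bounded_onD(1)[OF Q_W] in blast)
  then show "\<exists>g\<in>W. \<exists>r. strict_mono r \<and> (\<lambda>n. l2_norm q (\<lambda>x. kernel_op Q (f (r n)) x - g x)) \<longlonglongrightarrow> 0"
    using g(2) lim by blast
qed

lemma iterate_intertwine:
  assumes "f \<in> l2 q"
  shows "(kernel_op P ^^ n) (\<Lambda> f) = \<Lambda> ((kernel_op Q ^^ n) f)"
  using intertwine[OF Q.iterate_mem[OF assms]] by (induction n) auto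

text \<open>
  The two conclusions are obtained together, since \<open>lambda_star\<close> is only identified with the norm of \<open>Q\<close> on \<open>W\<close>
  once the growth of \<open>P^n\<close> and an eigenfunction of that modulus are both at hand.
\<close>

theorem
  shows lambda_star_eigenfunction:
      "\<exists>z. \<exists>h\<in>l2_0 p. h \<noteq> (\<lambda>_. 0) \<and> kernel_op P h = (\<lambda>x. z * h x) \<and> cmod z = lam"
    and lambda_star_growth:
      "f \<in> l2_0 p \<Longrightarrow> l2_norm p ((kernel_op P ^^ n) f) \<le> kap * lam ^ n * l2_norm p f"
proof -
  define a where "a = Q.norm_on W (kernel_op Q)"
  have a0: "a \<ge> 0" unfolding a_def by (rule Q.norm_on_nonneg[OF W_closed Q_W])
  obtain w0 where w0: "w0 \<in> W" "w0 \<noteq> (\<lambda>_. 0)" using W_nontrivial by blast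
  obtain z k where k: "k \<in> W" "k \<noteq> (\<lambda>_. 0)" "kernel_op Q k = (\<lambda>x. z * k x)" "cmod z = a"
    using Q.normal_eigenvector[OF W_closed w0 Q_W adj_W _ _ compact_W] Q.adjoint commute W_D(1)
    unfolding a_def by blast
  note kq = W_D(1)[OF k(1)]
  define h where "h = \<Lambda> k"
  have h: "h \<in> l2 p" "h \<noteq> (\<lambda>_. 0)" "kernel_op P h = (\<lambda>x. z * h x)"
    using \<Lambda>_mem[OF kq] \<Lambda>_inj[OF kq Q.zero_mem] k(2) \<Lambda>_zero intertwine[OF kq] k(3) \<Lambda>_scale[OF kq]
    by (auto simp: h_def)
  have z1: "cmod z < 1"
  proof (rule ccontr)
    assume "\<not> cmod z < 1"
    then obtain c where "h = (\<lambda>_. c)" using P.peripheral_eigenfunction[OF h] by auto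
    then have "\<Lambda> k = \<Lambda> (\<lambda>x. c * e x)" using \<Lambda>_scale[OF e_mem] \<Lambda>_e by (simp add: h_def)
    then have kc: "k = (\<lambda>x. c * e x)" by (rule \<Lambda>_inj[OF kq Q.scale_mem[OF e_mem]])
    then have "c * of_real ((l2_norm q e)\<^sup>2) = 0"
      using W_D(2)[OF k(1)] Q.inner_scale_left[of c e e] Q.inner_self[OF e_mem] by simp
    then have "c = 0" using Q.norm_pos[OF e_mem e_nonzero] by simp
    then show False using kc k(2) by simp
  qed
  have h0: "h \<in> l2_0 p"
  proof -
    have "(z - 1) * l2_inner p h (\<lambda>_. 1) = 0"
      using P.mean_op[OF h(1)] unfolding h(3) P.inner_scale_left by (simp add: algebra_simps)
    moreover have "z \<noteq> 1" using z1 by auto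
    ultimately show ?thesis using h(1) by (simp add: l2_0_def)
  qed
  have growth: "l2_norm p ((kernel_op P ^^ n) f) \<le> kap * a ^ n * l2_norm p f" if f: "f \<in> l2_0 p" for f n
  proof -
    define g where "g = \<Lambda>' f"
    have g: "g \<in> l2 q" "\<Lambda> g = f" using \<Lambda>'_mem \<Lambda>_\<Lambda>' P.l2_0D(1)[OF f] by (auto simp: g_def)
    define c where "c = l2_inner q g e / of_real ((l2_norm q e)\<^sup>2)"
    define w where "w = (\<lambda>x. 1 * g x + (- c) * e x)"
    have w: "w \<in> W"
    proof -
      have "l2_inner q w e = 0"
        unfolding w_def Q.inner_lincomb_left[OF g(1) e_mem e_mem] Q.inner_self[OF e_mem]
        using Q.norm_pos[OF e_mem e_nonzero] by (simp add: c_def)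
      then show ?thesis using Q.lincomb_mem[OF g(1) e_mem, of 1 "- c"] by (simp add: W_def w_def)
    qed
    note wq = W_D(1)[OF w]
    have Qw: "(kernel_op Q ^^ m) w \<in> W \<and> l2_norm q ((kernel_op Q ^^ m) w) \<le> a ^ m * l2_norm q w" for m
      using Q.norm_on_iterate[OF W_closed Q_W w] by (simp add: a_def)
    have Qg: "(kernel_op Q ^^ m) g = (\<lambda>x. 1 * (kernel_op Q ^^ m) w x + c * e x)" for m
    proof (induction m)
      case 0 then show ?case by (simp add: w_def)
    next
      case (Suc m)
      show ?case
        using Q.bounded_onD(2)[OF Q.bounded_l2 Q.iterate_mem[OF wq, of m] e_mem, of 1 c]
        by (simp add: Suc Q_e)
    qed
    \<comment> \<open>Because the iterates of w tend to 0, the constant c is the limit of the means of P^m f.\<close>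
    have "cmod c \<le> (op_norm q p \<Lambda> * l2_norm q w) * a ^ m" for m
    proof -
      let ?v = "\<Lambda> ((kernel_op Q ^^ m) w)"
      have v: "?v \<in> l2 p" by (intro \<Lambda>_mem Q.iterate_mem wq)
      have "(kernel_op P ^^ m) f = (\<lambda>x. 1 * ?v x + c * 1)"
        unfolding g(2)[symmetric] iterate_intertwine[OF g(1)] Qg
          \<Lambda>_lin[OF Q.iterate_mem[OF wq] e_mem] \<Lambda>_e ..
      then have "l2_inner p ?v (\<lambda>_. 1) + c = 0"
        using P.l2_0D(2)[OF P.iterate_l2_0[OF f, of m]] P.inner_lincomb_left[OF v P.one_mem P.one_mem, of 1 c]
          P.inner_self[OF P.one_mem] by (simp add: P.norm_one)
      then have "cmod c = cmod (l2_inner p ?v (\<lambda>_. 1))" by (metis add_eq_0_iff norm_minus_cancel)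
      also have "\<dots> \<le> l2_norm p ?v" using P.Cauchy_Schwarz[OF v P.one_mem] by (simp add: P.norm_one)
      also have "\<dots> \<le> op_norm q p \<Lambda> * (a ^ m * l2_norm q w)"
        using \<Lambda>_norm(1)[OF W_D(1)[OF conjunct1[OF Qw[of m]]]] mult_left_mono[OF conjunct2[OF Qw[of m]] \<Lambda>_norm(2)]
        by linarith
      finally show ?thesis by (simp add: mult_ac)
    qed
    moreover have "(\<lambda>m. (op_norm q p \<Lambda> * l2_norm q w) * a ^ m) \<longlonglongrightarrow> (op_norm q p \<Lambda> * l2_norm q w) * 0"
      using z1 k(4) a0 by (intro tendsto_intros LIMSEQ_power_zero) auto
    ultimately have "cmod c \<le> 0" by (intro LIMSEQ_le_const) auto
    then have gw: "g = w" by (simp add: w_def)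
    show ?thesis
      using norm_le_kap[OF P.l2_0D(1)[OF f], of "kernel_op Q ^^ n" "a ^ n"] Q.iterate_mem[OF g(1)] Qw[of n] a0
        iterate_intertwine[OF g(1), of n]
      unfolding g_def[symmetric] g(2) gw[symmetric] by simp
  qed
  have "lam = cmod z"
    unfolding lambda_star_def
    by (rule P.spectral_radius_eqI[OF P.l2_0_closed P.op_l2_0 kap_nonneg _ h0 h(2,3)]) (simp add: growth k(4))
  then show "\<exists>z. \<exists>h\<in>l2_0 p. h \<noteq> (\<lambda>_. 0) \<and> kernel_op P h = (\<lambda>x. z * h x) \<and> cmod z = lam"
    and "f \<in> l2_0 p \<Longrightarrow> l2_norm p ((kernel_op P ^^ n) f) \<le> kap * lam ^ n * l2_norm p f"
    using h0 h growth k(4) by auto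
qed

lemma lam_nonneg: "lam \<ge> 0"
  using lambda_star_eigenfunction norm_ge_zero by metis

lemma sig_nonneg: "sig \<ge> 0"
  using P.sigma_star_bound(1)[OF compact] nontrivial by blast

lemma op_norm_lower: "lam ^ n \<le> op_norm p p (pow_minus_stationary p P n)"
  using lambda_star_eigenfunction P.eigenvalue_power_le_op_norm by metis

lemma op_norm_le_sig: "op_norm p p (pow_minus_stationary p P n) \<le> sig ^ n"
proof (rule P.op_norm_bound)
  obtain x y :: 'a where "x \<noteq> y" using nontrivial by blast
  note bound = P.sigma_star_bound(2)[OF compact this]
  show "l2_norm p ((kernel_op P ^^ n) f) \<le> sig ^ n * l2_norm p f" if "f \<in> l2_0 p" for f
    using P.power_bound[OF sig_nonneg bound that] by blast
qed (simp add: sig_nonneg)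

lemma op_norm_le_lam: "op_norm p p (pow_minus_stationary p P n) \<le> kap * lam ^ n"
  by (rule P.op_norm_bound) (simp_all add: lambda_star_growth kap_nonneg lam_nonneg)

lemma lam_le_sig: "lam \<le> sig"
  using order_trans[OF op_norm_lower[of 1] op_norm_le_sig[of 1]] by simp

text \<open>
  If \<open>lambda_star = 0\<close>, the growth bound with exponent 1 makes \<open>P\<close> vanish on the functions of mean zero.
\<close>

lemma sig_eq_0:
  assumes "lam = 0"
  shows "sig = 0"
proof -
  have P0: "kernel_op P f = (\<lambda>_. 0)" if f: "f \<in> l2_0 p" for f
  proof (rule P.norm_eq_0_imp[OF P.op_mem[OF P.l2_0D(1)[OF f]]])
    show "l2_norm p (kernel_op P f) = 0"
      using lambda_star_growth[OF f, of 1] assms P.norm_nonneg[of "kernel_op P f"] by simp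
  qed
  obtain x y :: 'a where "x \<noteq> y" using nontrivial by blast
  from P.sigma_star_bound(3)[OF compact this]
  obtain k where k: "k \<in> l2_0 p" "k \<noteq> (\<lambda>_. 0)"
    "l2_norm p (kernel_op P (P.adj_op k)) = sig\<^sup>2 * l2_norm p k" by blast
  have "sig\<^sup>2 * l2_norm p k = 0" using k(3) P0[OF P.bounded_onD(1)[OF P.adj_l2_0 k(1)]] by simp
  then show ?thesis using P.norm_pos[OF P.l2_0D(1)[OF k(1)] k(2)] by simp
qed

end

section \<open>Comparing the two geometric rates\<close>

text \<open>
  Taking logarithms, \<open>sig^n < kap lam^n\<close> means that \<open>n\<close> lies below the real number whose ceiling is the
  threshold. The last assumption keeps \<open>ln lam\<close> meaningful when \<open>lam < sig\<close>; for \<open>lam = sig\<close> the threshold is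
  infinite and \<open>kap \<ge> 1\<close> makes the first term the smaller one.
\<close>

lemma min_eq_n_star_switch:
  fixes lam sig kap :: real
  assumes lam: "0 \<le> lam" "lam \<le> sig" and kap: "1 \<le> kap" and degenerate: "lam = 0 \<Longrightarrow> sig = 0"
  shows "min (sig ^ n) (kap * lam ^ n) = sig ^ n * of_bool (enat n < n_star kap sig lam)
    + kap * lam ^ n * of_bool (n_star kap sig lam \<le> enat n)"
proof (cases "lam = sig")
  case True
  have "sig ^ n * 1 \<le> sig ^ n * kap" using kap lam by (intro mult_left_mono) auto
  then show ?thesis using True by (simp add: n_star_def mult.commute)
next
  case False
  then have lt: "lam < sig" "0 < lam" using lam degenerate by (auto simp: less_le)
  define x where "x = ln kap / (ln sig - ln lam)"
  define N where "N = nat \<lceil>x\<rceil>"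
  have D: "ln sig - ln lam > 0" using lt by simp
  have "n < N \<longleftrightarrow> real n < x"
    unfolding N_def by (simp add: zless_nat_eq_int_zless less_ceiling_iff)
  also have "\<dots> \<longleftrightarrow> real n * (ln sig - ln lam) < ln kap"
    unfolding x_def using D by (simp add: pos_less_divide_eq)
  also have "\<dots> \<longleftrightarrow> ln (sig ^ n) < ln (kap * lam ^ n)"
    using lt kap by (simp add: ln_mult ln_realpow algebra_simps)
  also have "\<dots> \<longleftrightarrow> sig ^ n < kap * lam ^ n"
    using lt kap by (intro ln_less_cancel_iff) auto
  finally have "n < N \<longleftrightarrow> sig ^ n < kap * lam ^ n" .
  moreover have "n_star kap sig lam = enat N" using lt by (simp add: n_star_def x_def N_def)
  ultimately show ?thesis by (cases "n < N") auto
qed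

lemma eventually_geometric_less:
  fixes lam sig kap :: real
  assumes "0 \<le> lam" "lam < sig"
  shows "\<forall>\<^sub>F n in sequentially. kap * lam ^ n < sig ^ n"
proof -
  have "(\<lambda>n. kap * (lam / sig) ^ n) \<longlonglongrightarrow> kap * 0"
    using assms by (intro tendsto_intros LIMSEQ_power_zero) (simp add: divide_less_eq)
  then have "\<forall>\<^sub>F n in sequentially. kap * (lam / sig) ^ n < 1"
    by (intro order_tendstoD(2)) auto
  then show ?thesis
    by (rule eventually_mono) (use assms in \<open>simp add: power_divide divide_less_eq\<close>)
qed

theorem corollary2p2:
  fixes P Q :: "'a::countable \<Rightarrow> 'a \<Rightarrow> real"
    and \<pi> \<pi>Q :: "'a \<Rightarrow> real"
    and \<Lambda> :: "('a \<Rightarrow> complex) \<Rightarrow> ('a \<Rightarrow> complex)"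
    and lam sig kap :: real
  assumes nontrivial: "\<exists>x y :: 'a. x \<noteq> y"
    and P: "markov_kernel P" "\<forall>x. \<pi> x > 0"
    and ergodic: "ergodic_kernel P \<pi>"
    and Q: "normal_kernel \<pi>Q Q"
    and similar: "similar_kernels \<pi> P \<Lambda> \<pi>Q Q"
    and compact: "compact_op \<pi> \<pi> (kernel_op P)"
  defines "lam \<equiv> lambda_star \<pi> (kernel_op P)"
    and "sig \<equiv> sigma_star \<pi> P"
    and "kap \<equiv> condition_number \<pi> \<pi>Q \<Lambda>"
  shows
    "(\<forall>n. lam ^ n \<le> op_norm \<pi> \<pi> (pow_minus_stationary \<pi> P n) \<and>
          op_norm \<pi> \<pi> (pow_minus_stationary \<pi> P n) \<le> min (sig ^ n) (kap * lam ^ n) \<and>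
          min (sig ^ n) (kap * lam ^ n) =
            sig ^ n * of_bool (enat n < n_star kap sig lam) +
            kap * lam ^ n * of_bool (enat n \<ge> n_star kap sig lam)) \<and>
     kap \<ge> 1 \<and>
     (finite (UNIV :: 'a set) \<longrightarrow> max_centered_diagonal \<pi> P > lam \<longrightarrow> lam < sig) \<and>
     (lam < sig \<longrightarrow> (\<forall>\<^sub>F n in sequentially. kap * lam ^ n < sig ^ n)) \<and>
     (finite (UNIV :: 'a set) \<longrightarrow>
        (\<forall>n. tv_distance \<pi> P n \<le>
               min (sig ^ n) (kap * lam ^ n) / 2 * sqrt ((1 - min_prob \<pi>) / min_prob \<pi>)) \<and>
        lam \<le> sig)"
proof -
  interpret normal_similarity \<pi> \<pi>Q P Q \<Lambda>
  proof unfold_locales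
    show "bounded_op \<pi> \<pi> (kernel_op P)" using compact by (simp add: compact_op_def)
  qed (use assms in \<open>auto simp: ergodic_kernel_def normal_kernel_def\<close>)
  have upper: "op_norm \<pi> \<pi> (pow_minus_stationary \<pi> P n) \<le> min (sig ^ n) (kap * lam ^ n)" for n
    using op_norm_le_sig op_norm_le_lam by (simp add: lam_def sig_def kap_def)
  have switch: "min (sig ^ n) (kap * lam ^ n) =
      sig ^ n * of_bool (enat n < n_star kap sig lam) +
      kap * lam ^ n * of_bool (enat n \<ge> n_star kap sig lam)" for n
    unfolding lam_def sig_def kap_def
    by (rule min_eq_n_star_switch[OF lam_nonneg lam_le_sig kap_ge_1 sig_eq_0])
  have diag: "lam < sig" if fin: "finite (UNIV :: 'a set)" and gt: "max_centered_diagonal \<pi> P > lam"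
  proof -
    have "max_centered_diagonal \<pi> P \<in> range (\<lambda>i. P i i - \<pi> i)"
      unfolding max_centered_diagonal_def using fin by (intro Max_in) auto
    then obtain i where "lam < P i i - \<pi> i" using gt by auto
    also have "\<dots> \<le> op_norm \<pi> \<pi> (pow_minus_stationary \<pi> P 1)" by (rule P.centered_diagonal_le_op_norm)
    also have "\<dots> \<le> sig" using op_norm_le_sig[of 1] by (simp add: sig_def)
    finally show ?thesis .
  qed
  have tv: "tv_distance \<pi> P n \<le> min (sig ^ n) (kap * lam ^ n) / 2 * sqrt ((1 - min_prob \<pi>) / min_prob \<pi>)"
    if fin: "finite (UNIV :: 'a set)" for n
  proof -
    define m where "m = min_prob \<pi>"
    have m: "m > 0" "m \<le> \<pi> x" for x
      using Min_in[of "range \<pi>"] Min_le[of "range \<pi>" "\<pi> x"] fin P(2) by (auto simp: m_def min_prob_def)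
    have "total_variation (kernel_pow P n x) \<pi> \<le> min (sig ^ n) (kap * lam ^ n) / 2 * sqrt ((1 - m) / m)" for x
    proof -
      have "1 / \<pi> x - 1 \<le> (1 - m) / m"
        using m P(2) by (simp add: diff_divide_distrib frac_le)
      moreover have "1 / \<pi> x - 1 \<ge> 0" using P.norm_evaluator[of x] by (metis zero_le_power2)
      ultimately have "op_norm \<pi> \<pi> (pow_minus_stationary \<pi> P n) / 2 * sqrt (1 / \<pi> x - 1)
          \<le> min (sig ^ n) (kap * lam ^ n) / 2 * sqrt ((1 - m) / m)"
        using upper[of n] order_trans[OF zero_le_power[OF lam_nonneg] op_norm_lower, of n]
        by (intro mult_mono) auto
      then show ?thesis using P.total_variation_le_op_norm[OF fin, of n x] by linarith
    qed
    then show ?thesis unfolding tv_distance_def m_def using fin by (subst Max_le_iff) auto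
  qed
  show ?thesis
  proof (intro conjI allI impI)
    show "lam ^ n \<le> op_norm \<pi> \<pi> (pow_minus_stationary \<pi> P n)" for n
      unfolding lam_def by (rule op_norm_lower)
    show "kap \<ge> 1" unfolding kap_def by (rule kap_ge_1)
    show "lam \<le> sig" unfolding lam_def sig_def by (rule lam_le_sig)
    show "\<forall>\<^sub>F n in sequentially. kap * lam ^ n < sig ^ n" if "lam < sig"
      using that lam_nonneg unfolding lam_def by (intro eventually_geometric_less)
  qed (fact upper switch diag tv)+
qed

end
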